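(* Let $G=(V,E)$ be an undirected connected multi-graph on $n$ vertices and let $S\subseteq V$ be any Steiner set of $G$ with $|S|\ge 2$. Let $\lambda_S$ be the capacity of an $S$-mincut of $G$. There is a data structure occupying $\mathcal{O}(n(n-|S|+1))$ space that, given any pair of vertices $u,v$ of $G$, can determine in $\mathcal{O}(1)$ time whether the least capacity Steiner cut separating $u$ and $v$ has capacity $\lambda_S+1$. Moreover, the data structure can report a Steiner cut $C$ of capacity $\lambda_S+1$ separating $u$ and $v$ in $\mathcal{O}(n)$ time, if such a cut exists.
   Context: A cut is a set of vertices $C\subset V$ (nonempty, proper); $\overline{C}=V\setminus C$. A cut $C$ separates $u,v$ if exactly one of them lies in $C$. The capacity $c(C)$ is the number of edges (counted with multiplicity) with one endpoint in $C$ and the other in $\overline{C}$. A cut $C$ is a Steiner cut if there are $s_1,s_2\in S$ with $s_1\in C$, $s_2\notin C$. An $S$-mincut is a Steiner cut of minimum capacity, and $\lambda_S$ denotes that minimum capacity. Space is measured in machine words and time in the standard word-RAM model. *)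

theory Defs
  imports Complex_Main "HOL-Library.Multiset"
begin

section \<open>Multigraphs and Steiner cuts\<close>

text \<open>An undirected multigraph is a vertex set together with a multiset of edges, where an edge is
  the set of its endpoints. Loops (edges with a single endpoint) are permitted; they cross no cut.\<close>

definition multigraph :: "'a set \<Rightarrow> 'a set multiset \<Rightarrow> bool" where
  "multigraph V E \<longleftrightarrow> finite V \<and> (\<forall>e\<in>#E. \<exists>x\<in>V. \<exists>y\<in>V. e = {x, y})"

definition connected_multigraph :: "'a set \<Rightarrow> 'a set multiset \<Rightarrow> bool" where
  "connected_multigraph V E \<longleftrightarrow>
     multigraph V E \<and> V \<noteq> {} \<and> (\<forall>u\<in>V. \<forall>v\<in>V. (u, v) \<in> {(x, y). {x, y} \<in># E}\<^sup>*)"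

definition cut :: "'a set \<Rightarrow> 'a set \<Rightarrow> bool" where
  "cut V C \<longleftrightarrow> C \<noteq> {} \<and> C \<subset> V"

definition separates :: "'a set \<Rightarrow> 'a \<Rightarrow> 'a \<Rightarrow> bool" where
  "separates C u v \<longleftrightarrow> (u \<in> C) \<noteq> (v \<in> C)"

definition capacity :: "'a set \<Rightarrow> 'a set multiset \<Rightarrow> 'a set \<Rightarrow> nat" where
  "capacity V E C = size {#e \<in># E. \<exists>x\<in>C. \<exists>y\<in>V - C. e = {x, y}#}"

definition steiner_cut :: "'a set \<Rightarrow> 'a set \<Rightarrow> 'a set \<Rightarrow> bool" where
  "steiner_cut V S C \<longleftrightarrow> cut V C \<and> (\<exists>s1\<in>S. \<exists>s2\<in>S. s1 \<in> C \<and> s2 \<notin> C)"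

definition mincut_capacity :: "'a set \<Rightarrow> 'a set multiset \<Rightarrow> 'a set \<Rightarrow> nat" where
  "mincut_capacity V E S = Min (capacity V E ` {C. steiner_cut V S C})"

definition least_separating_steiner_cut ::
    "'a set \<Rightarrow> 'a set multiset \<Rightarrow> 'a set \<Rightarrow> 'a \<Rightarrow> 'a \<Rightarrow> 'a set \<Rightarrow> bool" where
  "least_separating_steiner_cut V E S u v C \<longleftrightarrow>
     is_arg_min (capacity V E) (\<lambda>C. steiner_cut V S C \<and> separates C u v) C"


section \<open>The word RAM\<close>

text \<open>Words of \<open>w\<close> bits are the natural numbers below \<open>2 ^ w\<close>. A program mentions finitely many
  registers; memory is addressed by words. Every instruction and every branch test takes one unit
  of time.\<close>

type_synonym reg = nat

datatype binop = Add | Sub | Mul | Div | Mod | And | Or | Xor | Shl | Shr | Less | Equal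

fun binop_val :: "nat \<Rightarrow> binop \<Rightarrow> nat \<Rightarrow> nat \<Rightarrow> nat" where
  "binop_val w Add x y = (x + y) mod 2 ^ w"
| "binop_val w Sub x y = nat ((int x - int y) mod 2 ^ w)"
| "binop_val w Mul x y = (x * y) mod 2 ^ w"
| "binop_val w Div x y = x div y"
| "binop_val w Mod x y = x mod y"
| "binop_val w And x y = and x y"
| "binop_val w Or x y = or x y"
| "binop_val w Xor x y = xor x y"
| "binop_val w Shl x y = (x * 2 ^ y) mod 2 ^ w"
| "binop_val w Shr x y = x div 2 ^ y"
| "binop_val w Less x y = of_bool (x < y)"
| "binop_val w Equal x y = of_bool (x = y)"

datatype prog =
    Skip
  | Const reg nat
  | Bin binop reg reg reg
  | Load reg reg
  | Store reg reg
  | Emit reg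
  | Seq prog prog
  | Cond reg prog prog
  | While reg prog

record ram =
  regs :: "reg \<Rightarrow> nat"
  mem :: "nat \<Rightarrow> nat"
  emitted :: "nat list"

text \<open>\<open>exec w P s t s'\<close>: started in \<open>s\<close> on a machine with word size \<open>w\<close>, the program \<open>P\<close> halts in \<open>s'\<close>
  after exactly \<open>t\<close> time units.\<close>

inductive exec :: "nat \<Rightarrow> prog \<Rightarrow> ram \<Rightarrow> nat \<Rightarrow> ram \<Rightarrow> bool" for w :: nat where
  Skip: "exec w Skip s 1 s"
| Const: "exec w (Const r k) s 1 (s\<lparr>regs := (regs s)(r := k mod 2 ^ w)\<rparr>)"
| Bin: "exec w (Bin f r a b) s 1 (s\<lparr>regs := (regs s)(r := binop_val w f (regs s a) (regs s b))\<rparr>)"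
| Load: "exec w (Load r a) s 1 (s\<lparr>regs := (regs s)(r := mem s (regs s a))\<rparr>)"
| Store: "exec w (Store a r) s 1 (s\<lparr>mem := (mem s)(regs s a := regs s r)\<rparr>)"
| Emit: "exec w (Emit r) s 1 (s\<lparr>emitted := emitted s @ [regs s r]\<rparr>)"
| Seq: "exec w P s t1 s' \<Longrightarrow> exec w Q s' t2 s'' \<Longrightarrow> exec w (Seq P Q) s (t1 + t2) s''"
| CondTrue: "regs s r \<noteq> 0 \<Longrightarrow> exec w P s t s' \<Longrightarrow> exec w (Cond r P Q) s (t + 1) s'"
| CondFalse: "regs s r = 0 \<Longrightarrow> exec w Q s t s' \<Longrightarrow> exec w (Cond r P Q) s (t + 1) s'"
| WhileFalse: "regs s r = 0 \<Longrightarrow> exec w (While r P) s 1 s"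
| WhileTrue: "regs s r \<noteq> 0 \<Longrightarrow> exec w P s t1 s' \<Longrightarrow> exec w (While r P) s' t2 s'' \<Longrightarrow>
    exec w (While r P) s (t1 + t2 + 1) s''"

inductive_cases exec_elims:
  "exec w Skip s t s'" "exec w (Const r k) s t s'" "exec w (Bin f r a b) s t s'"
  "exec w (Load r a) s t s'" "exec w (Store a r) s t s'" "exec w (Emit r) s t s'"
  "exec w (Seq P Q) s t s'" "exec w (Cond r P Q) s t s'" "exec w (While r P) s t s'"

lemma exec_deterministic:
  "exec w P s t s' \<Longrightarrow> exec w P s t' s'' \<Longrightarrow> t' = t \<and> s'' = s'"
proof (induction arbitrary: t' s'' rule: exec.induct)
  case (Seq P s t1 s1 Q t2 s2)
  show ?case by (rule exec_elims(7)[OF Seq.prems]) (metis Seq.IH)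
next
  case (CondTrue s r P t s1 Q)
  show ?case by (rule exec_elims(8)[OF CondTrue.prems]) (use CondTrue.hyps in \<open>simp_all add: CondTrue.IH\<close>)
next
  case (CondFalse s r Q t s1 P)
  show ?case by (rule exec_elims(8)[OF CondFalse.prems]) (use CondFalse.hyps in \<open>simp_all add: CondFalse.IH\<close>)
next
  case (WhileFalse s r P)
  show ?case by (rule exec_elims(9)[OF WhileFalse.prems]) (use WhileFalse.hyps in simp_all)
next
  case (WhileTrue s r P t1 s1 t2 s2)
  show ?case
  proof (rule exec_elims(9)[OF WhileTrue.prems])
    fix t3 s3 t4
    assume a: "t' = Suc (t3 + t4)" "exec w P s t3 s3" "exec w (While r P) s3 t4 s''"
    have "t3 = t1 \<and> s3 = s1" using WhileTrue.IH(1) a(2) by blast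
    with WhileTrue.IH(2)[of t4 s''] a show ?thesis by simp
  qed (use WhileTrue.hyps in simp_all)
qed (erule exec_elims, simp)+

text \<open>The data structure \<open>D\<close> occupies the first \<open>length D\<close> memory cells and the two query arguments
  are passed in registers \<open>0\<close> and \<open>1\<close>. All other registers and cells are working storage with
  arbitrary initial contents.\<close>

definition query_state :: "nat \<Rightarrow> nat list \<Rightarrow> nat \<Rightarrow> nat \<Rightarrow> ram \<Rightarrow> bool" where
  "query_state w D x y s \<longleftrightarrow>
     (\<forall>r. regs s r < 2 ^ w) \<and> (\<forall>a. mem s a < 2 ^ w) \<and> emitted s = [] \<and>
     regs s 0 = x \<and> regs s 1 = y \<and> (\<forall>i<length D. mem s i = D ! i)"

text \<open>The program \<open>P\<close> answers the query \<open>(x, y)\<close> on \<open>D\<close> within time \<open>T\<close> by emitting a list that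
  satisfies \<open>Q\<close>, and leaves \<open>D\<close> intact for subsequent queries.\<close>

definition answers_query ::
    "nat \<Rightarrow> prog \<Rightarrow> nat list \<Rightarrow> nat \<Rightarrow> nat \<Rightarrow> nat \<Rightarrow> (nat list \<Rightarrow> bool) \<Rightarrow> bool" where
  "answers_query w P D x y T Q \<longleftrightarrow>
     (\<forall>s. query_state w D x y s \<longrightarrow>
        (\<exists>t s'. exec w P s t s' \<and> t \<le> T \<and> Q (emitted s') \<and> (\<forall>i<length D. mem s' i = D ! i)))"

end

theory Submission
  imports Defs "HOL-Library.Sublist"
begin

text \<open>Deciding needs only two labels per vertex: not being separated by any Steiner cut of capacity
  \<open>\<lambda>\<close> (or \<open>\<lambda> + 1\<close>) is an equivalence relation.

  For reporting, at most one cut per vertex is needed to separate every separable pair, and the cuts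
  contributed by the nonterminals can be stored in full within the space bound. What remains is to
  separate pairs of terminals by cuts whose traces on \<open>S\<close> take \<open>O(1)\<close> words. By the parity
  refinement \<open>c(A) + c(B) = c(A \<inter> B) + c(A \<union> B) + 2 d\<close> of submodularity, two crossing cuts of
  capacity \<open>\<lambda> + 1\<close> either have a diagonal of opposite corners of capacity \<open>\<lambda> + 1\<close>, and can be
  uncrossed, or have a corner of capacity \<open>\<lambda>\<close> on each diagonal, so that one of them is composite:
  up to complement a disjoint union of two minimum cuts. Hence a maximal cross-free family \<open>K\<close> of
  noncomposite cuts together with all composite cuts separates every separable pair of terminals.
  Composite cuts exist only for odd \<open>\<lambda>\<close>, and then, again by parity, minimum cuts cross neither each
  other nor noncomposite cuts. So one linear order of \<open>S\<close> turns the members of \<open>K\<close> and the minimum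
  cuts into intervals, up to complement, and composite cuts into symmetric differences of two
  intervals.\<close>

section \<open>Uncrossing Steiner cuts\<close>

definition edges_between :: "'a set multiset \<Rightarrow> 'a set \<Rightarrow> 'a set \<Rightarrow> 'a set multiset" where
  "edges_between E X Y = {#e \<in># E. \<exists>x\<in>X. \<exists>y\<in>Y. e = {x, y}#}"

lemma capacity_eq_edges_between: "capacity V E C = size (edges_between E C (V - C))"
  by (simp add: capacity_def edges_between_def)

lemma size_edges_between_add_mset:
  "size (edges_between (add_mset {x, y} E) X Y) =
     size (edges_between E X Y) + of_bool (x \<in> X \<and> y \<in> Y \<or> x \<in> Y \<and> y \<in> X)"
  by (auto simp: edges_between_def doubleton_eq_iff)

lemma edges_between_commute: "edges_between E X Y = edges_between E Y X"
  unfolding edges_between_def by (metis insert_commute)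

lemma capacity_complement: "C \<subseteq> V \<Longrightarrow> capacity V E (V - C) = capacity V E C"
  unfolding capacity_eq_edges_between by (metis double_diff edges_between_commute subset_refl)

lemma capacity_Int_Un:
  assumes "multigraph V E"
  shows "capacity V E A + capacity V E B =
    capacity V E (A \<inter> B) + capacity V E (A \<union> B) + 2 * size (edges_between E (A - B) (B - A))"
  using assms
proof (induction E)
  case empty
  then show ?case by (simp add: capacity_def edges_between_def)
next
  case (add e E)
  then obtain x y where "x \<in> V" "y \<in> V" "e = {x, y}"
    by (auto simp: multigraph_def)
  moreover have "multigraph V E"
    using add.prems by (simp add: multigraph_def)
  ultimately show ?case
    using add.IH unfolding capacity_eq_edges_between
    by (cases "x \<in> A"; cases "x \<in> B"; cases "y \<in> A"; cases "y \<in> B")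
      (simp_all add: size_edges_between_add_mset)
qed

lemma capacity_Diff_Diff:
  assumes "multigraph V E" "A \<subseteq> V" "B \<subseteq> V"
  shows "capacity V E A + capacity V E B =
    capacity V E (A - B) + capacity V E (B - A) + 2 * size (edges_between E (A \<inter> B) (V - (A \<union> B)))"
proof -
  have "A \<inter> (V - B) = A - B" "A \<union> (V - B) = V - (B - A)" "A - (V - B) = A \<inter> B"
    "V - B - A = V - (A \<union> B)"
    using assms by blast+
  moreover have "capacity V E (V - (B - A)) = capacity V E (B - A)"
    using assms by (intro capacity_complement) blast
  ultimately show ?thesis
    using capacity_Int_Un[OF assms(1), of A "V - B"] capacity_complement[OF assms(3), of E] by simp
qed

definition crosses :: "'a set \<Rightarrow> 'a set \<Rightarrow> 'a set \<Rightarrow> bool" where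
  "crosses S A B \<longleftrightarrow>
     S \<inter> A \<inter> B \<noteq> {} \<and> S \<inter> A - B \<noteq> {} \<and> S \<inter> B - A \<noteq> {} \<and> S - A - B \<noteq> {}"

abbreviation cross_free :: "'a set \<Rightarrow> 'a set set \<Rightarrow> bool" where
  "cross_free S \<equiv> pairwise (\<lambda>A B. \<not> crosses S A B)"

lemma crosses_commute: "crosses S A B \<longleftrightarrow> crosses S B A"
  by (auto simp: crosses_def)

lemma not_crosses_refl: "\<not> crosses S A A"
  by (simp add: crosses_def)

lemma crosses_Compl:
  "crosses S (- A) B \<longleftrightarrow> crosses S A B" "crosses S A (- B) \<longleftrightarrow> crosses S A B"
  unfolding crosses_def by blast+

lemma corner_not_crosses: "Y \<in> {A \<inter> B, A \<union> B, A - B, B - A} \<Longrightarrow> \<not> crosses S Y B"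
  unfolding crosses_def by blast

lemma crosses_Int_imp_crosses:
  assumes "crosses S A B" "\<not> crosses S X B" "crosses S (A \<inter> B) X"
  shows "crosses S A X"
proof (rule ccontr)
  assume "\<not> crosses S A X"
  then have "S \<inter> X \<subseteq> A \<or> S - X \<subseteq> A"
    using assms(3) unfolding crosses_def by blast
  moreover have "S \<inter> X \<subseteq> B \<or> S - X \<subseteq> B"
    using assms(2,3) unfolding crosses_def by blast
  ultimately show False
    using assms(1,3) unfolding crosses_def by blast
qed

lemma crosses_corner_imp_crosses:
  assumes "crosses S A B" "\<not> crosses S X B" "Y \<in> {A \<inter> B, A \<union> B, A - B, B - A}" "crosses S Y X"
  shows "crosses S A X"
proof -
  have "A \<union> B = - (- A \<inter> - B)" "A - B = A \<inter> - B" "B - A = - A \<inter> B"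
    by blast+
  then have "crosses S (A \<inter> B) X \<or> crosses S (- A \<inter> - B) X \<or> crosses S (A \<inter> - B) X \<or>
      crosses S (- A \<inter> B) X"
    using assms(3,4) crosses_Compl(1) by (metis insertE empty_iff)
  then show ?thesis
    using assms(1,2) crosses_Int_imp_crosses crosses_Compl by metis
qed

lemma card_crossing_corner_less:
  assumes "finite K" "cross_free S K" "B \<in> K" "crosses S A B"
    "Y \<in> {A \<inter> B, A \<union> B, A - B, B - A}"
  shows "card {X \<in> K. crosses S Y X} < card {X \<in> K. crosses S A X}"
proof (rule psubset_card_mono)
  have "\<not> crosses S X B" if "X \<in> K" for X
    using assms(2,3) that by (metis not_crosses_refl pairwiseD)
  then show "{X \<in> K. crosses S Y X} \<subset> {X \<in> K. crosses S A X}"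
    using crosses_corner_imp_crosses[OF assms(4) _ assms(5)] corner_not_crosses[OF assms(5)]
      assms(3,4) by blast
qed (use assms(1) in simp)

lemma finite_maximal_pairwise:
  assumes "finite F" "symp R"
  obtains K where "K \<subseteq> F" "pairwise R K" "\<And>x. x \<in> F \<Longrightarrow> (\<forall>y\<in>K. R x y) \<Longrightarrow> x \<in> K"
proof -
  let ?P = "{K \<in> Pow F. pairwise R K}"
  have "{} \<in> ?P" by simp
  then have "?P \<noteq> {}" by blast
  moreover have "finite ?P" using assms(1) by simp
  ultimately obtain K where K: "K \<in> ?P" and max: "\<And>K'. K' \<in> ?P \<Longrightarrow> K \<subseteq> K' \<Longrightarrow> K = K'"
    using finite_has_maximal[of ?P] by metis
  show ?thesis
  proof (rule that)
    fix x assume "x \<in> F" "\<forall>y\<in>K. R x y"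
    then have "insert x K \<in> ?P"
      using K assms(2) by (auto simp: pairwise_insert dest: sympD)
    from max[OF this] show "x \<in> K" by blast
  qed (use K in auto)
qed

section \<open>Laminar families and linear orders\<close>

definition segment :: "'a list \<Rightarrow> 'a set \<Rightarrow> bool" where
  "segment xs X \<longleftrightarrow> (\<exists>zs. sublist zs xs \<and> set zs = X)"

lemma segment_empty: "segment xs {}"
  by (auto simp: segment_def intro: exI[of _ "[]"])

lemma segment_set: "segment xs (set xs)"
  by (auto simp: segment_def)

lemma segment_append:
  assumes "segment xs X \<or> segment ys X"
  shows "segment (xs @ ys) X"
  using assms sublist_order.order_trans[OF _ sublist_append_leftI]
    sublist_order.order_trans[OF _ sublist_append_rightI]
  unfolding segment_def by blast

abbreviation laminar :: "'a set set \<Rightarrow> bool" where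
  "laminar \<equiv> pairwise (\<lambda>X Y. X \<inter> Y = {} \<or> X \<subseteq> Y \<or> Y \<subseteq> X)"

lemma laminar_maximal_cases:
  assumes "laminar L" "X \<in> L" "Y \<in> L" "Y \<subseteq> U"
    and "X \<noteq> {}" "X \<subseteq> Y \<Longrightarrow> Y \<noteq> U \<Longrightarrow> X = Y"
  shows "Y = U \<or> Y \<subseteq> X \<or> Y \<subseteq> U - X"
proof (cases "X \<subseteq> Y")
  case True
  then show ?thesis using assms(6) by blast
next
  case False
  then have "X \<inter> Y = {} \<or> Y \<subseteq> X"
    using assms(1-3) by (auto simp: pairwise_def)
  then show ?thesis using assms(4) by blast
qed

text \<open>Splitting the ground set along a maximal proper member \<open>X\<close> leaves every other member on one
  side of \<open>X\<close>, so that orderings of the two sides can be concatenated.\<close>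

lemma laminar_segments:
  assumes "finite U" "L \<subseteq> Pow U" "laminar L"
  shows "\<exists>xs. distinct xs \<and> set xs = U \<and> (\<forall>X\<in>L. segment xs X)"
  using assms
proof (induction U arbitrary: L rule: finite_psubset_induct)
  case (psubset U)
  let ?P = "{X \<in> L. X \<noteq> {} \<and> X \<noteq> U}"
  show ?case
  proof (cases "?P = {}")
    case True
    then have "X = {} \<or> X = U" if "X \<in> L" for X
      using that by blast
    then show ?thesis
      using finite_distinct_list[OF psubset.hyps] segment_empty segment_set by metis
  next
    case False
    have "finite ?P"
      by (rule finite_subset[of _ "Pow U"]) (use psubset in auto)
    then obtain X where "X \<in> ?P" and maximal: "\<And>Y. Y \<in> ?P \<Longrightarrow> X \<subseteq> Y \<Longrightarrow> X = Y"
      using finite_has_maximal[OF _ False] by auto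
    then have X: "X \<in> L" "X \<noteq> {}" "X \<subset> U" "U - X \<subset> U"
      using psubset.prems(1) by auto
    have side: "Y = U \<or> Y \<subseteq> X \<or> Y \<subseteq> U - X" if "Y \<in> L" for Y
      using laminar_maximal_cases[OF psubset.prems(2) X(1) that] that psubset.prems(1) X(2)
        maximal[of Y] by blast
    have IH: "\<exists>xs. distinct xs \<and> set xs = W \<and> (\<forall>Y\<in>{Y \<in> L. Y \<subseteq> W}. segment xs Y)" if "W \<subset> U" for W
      using psubset.prems(2) by (intro psubset.IH[OF that]) (auto elim: pairwise_subset)
    obtain xs where xs: "distinct xs" "set xs = X" "\<And>Y. Y \<in> L \<Longrightarrow> Y \<subseteq> X \<Longrightarrow> segment xs Y"
      using IH[OF X(3)] by auto
    obtain ys where ys: "distinct ys" "set ys = U - X" "\<And>Y. Y \<in> L \<Longrightarrow> Y \<subseteq> U - X \<Longrightarrow> segment ys Y"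
      using IH[OF X(4)] by auto
    have "distinct (xs @ ys)" "set (xs @ ys) = U"
      using xs(1,2) ys(1,2) X(3) by auto
    moreover have "segment (xs @ ys) Y" if "Y \<in> L" for Y
      using side[OF that] xs(3)[OF that] ys(3)[OF that] segment_append[of xs Y ys]
        segment_set[of "xs @ ys"] \<open>set (xs @ ys) = U\<close> by metis
    ultimately show ?thesis by blast
  qed
qed

lemma cross_free_segments:
  assumes "finite S" "S \<noteq> {}" "cross_free S L"
  obtains xs where "distinct xs" "set xs = S"
    "\<And>A. A \<in> L \<Longrightarrow> segment xs (S \<inter> A) \<or> segment xs (S - A)"
proof -
  obtain s0 where "s0 \<in> S" using assms(2) by blast
  define side where "side A = (if s0 \<in> A then S - A else S \<inter> A)" for A
  have "side A \<inter> side B = {} \<or> side A \<subseteq> side B \<or> side B \<subseteq> side A" if "\<not> crosses S A B" for A B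
    using that \<open>s0 \<in> S\<close> unfolding crosses_def side_def by (auto split: if_splits)
  then have "laminar (side ` L)"
    using assms(3) unfolding pairwise_def by (metis image_iff)
  moreover have "side ` L \<subseteq> Pow S"
    by (auto simp: side_def)
  ultimately obtain xs where "distinct xs" "set xs = S" "\<And>A. A \<in> L \<Longrightarrow> segment xs (side A)"
    using laminar_segments[OF assms(1), of "side ` L"] by blast
  then show ?thesis
    using that[of xs] unfolding side_def by metis
qed

section \<open>Separating subfamilies\<close>

definition inseparable :: "'a set set \<Rightarrow> 'a \<Rightarrow> 'a \<Rightarrow> bool" where
  "inseparable F u v \<longleftrightarrow> (\<forall>C\<in>F. \<not> separates C u v)"

lemma inseparable_refl: "inseparable F u u"
  by (simp add: inseparable_def separates_def)

lemma inseparable_sym: "inseparable F u v \<Longrightarrow> inseparable F v u"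
  by (auto simp: inseparable_def separates_def)

lemma inseparable_trans: "inseparable F u v \<Longrightarrow> inseparable F v x \<Longrightarrow> inseparable F u x"
  by (auto simp: inseparable_def separates_def)

definition resolves :: "'a set set \<Rightarrow> 'a set set \<Rightarrow> 'a set \<Rightarrow> bool" where
  "resolves G F X \<longleftrightarrow> (\<forall>u\<in>X. \<forall>v\<in>X. inseparable G u v \<longrightarrow> inseparable F u v)"

text \<open>A cut that separates the new vertex \<open>z\<close> from one vertex of its current class separates it from
  the whole class.\<close>

lemma resolves_insert:
  assumes "resolves G F X" "x \<in> X" "inseparable G z x" "C \<in> F" "separates C z x"
  shows "resolves (insert C G) F (insert z X)"
proof -
  have new: "\<not> inseparable (insert C G) z y" if "y \<in> X" for y
  proof
    assume zy: "inseparable (insert C G) z y"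
    then have "inseparable G x y"
      using assms(3) by (auto simp: inseparable_def separates_def)
    then have "\<not> separates C x y"
      using assms(1,2,4) that by (auto simp: resolves_def inseparable_def)
    then show False
      using zy assms(5) by (auto simp: inseparable_def separates_def)
  qed
  have "inseparable F u v" if "u \<in> X" "v \<in> X" "inseparable (insert C G) u v" for u v
    using assms(1) that by (auto simp: resolves_def inseparable_def)
  with new show ?thesis
    unfolding resolves_def by (metis inseparable_refl inseparable_sym insertE)
qed

lemma resolves_extend:
  assumes "finite W" "resolves G F X"
  shows "\<exists>H\<subseteq>F. finite H \<and> card H \<le> card W \<and> resolves (G \<union> H) F (X \<union> W)"
  using assms(1)
proof induction
  case empty
  then show ?case using assms(2) by (intro exI[of _ "{}"]) simp
next
  case (insert z W)
  then obtain H where H: "H \<subseteq> F" "finite H" "card H \<le> card W" "resolves (G \<union> H) F (X \<union> W)"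
    by blast
  show ?case
  proof (cases "\<exists>x\<in>X \<union> W. inseparable (G \<union> H) z x \<and> \<not> inseparable F z x")
    case True
    then obtain x C where "x \<in> X \<union> W" "inseparable (G \<union> H) z x" "C \<in> F" "separates C z x"
      by (auto simp: inseparable_def)
    from resolves_insert[OF H(4) this] have "resolves (G \<union> insert C H) F (X \<union> insert z W)"
      by simp
    moreover have "card (insert C H) \<le> card (insert z W)"
      using H insert.hyps by (simp add: card_insert_if)
    ultimately show ?thesis
      using H \<open>C \<in> F\<close> by (intro exI[of _ "insert C H"]) simp
  next
    case False
    then have "resolves (G \<union> H) F (X \<union> insert z W)"
      using H(4) unfolding resolves_def
      by (metis Un_insert_right inseparable_refl inseparable_sym insertE)
    then show ?thesis
      using H insert.hyps by (intro exI[of _ H]) (simp add: le_SucI)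
  qed
qed

section \<open>Codes for cuts\<close>

lemma finite_preimage_list:
  assumes "finite A" "\<And>y. y \<in> A \<Longrightarrow> \<exists>x. P x \<and> f x = y"
  shows "\<exists>xs. length xs = card A \<and> f ` set xs = A \<and> (\<forall>x\<in>set xs. P x)"
proof -
  obtain ys where ys: "set ys = A" "length ys = card A"
    using finite_distinct_list[OF assms(1)] distinct_card by metis
  obtain g where "\<And>y. y \<in> A \<Longrightarrow> P (g y) \<and> f (g y) = y"
    using assms(2) by metis
  then show ?thesis
    using ys by (intro exI[of _ "map g ys"]) (auto simp: image_image)
qed

definition index_of :: "'a list \<Rightarrow> 'a \<Rightarrow> nat" where
  "index_of xs x = length (takeWhile (\<lambda>y. y \<noteq> x) xs)"

lemma index_of_less_length: "x \<in> set xs \<Longrightarrow> index_of xs x < length xs"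
  by (induction xs) (auto simp: index_of_def)

lemma index_of_append:
  "index_of (xs @ ys) x = (if x \<in> set xs then index_of xs x else length xs + index_of ys x)"
  by (induction xs) (auto simp: index_of_def)

lemma nth_index_of: "x \<in> set xs \<Longrightarrow> xs ! index_of xs x = x"
  using nth_length_takeWhile[of "\<lambda>y. y \<noteq> x" xs] index_of_less_length[of x xs]
  by (simp add: index_of_def)

primrec odd_above :: "nat list \<Rightarrow> nat \<Rightarrow> bool" where
  "odd_above [] i \<longleftrightarrow> False"
| "odd_above (t # ts) i \<longleftrightarrow> (i < t) \<noteq> odd_above ts i"

lemma segment_thresholds:
  assumes "segment xs X" "distinct xs"
  obtains l r where "l \<le> length xs" "r \<le> length xs"
    "\<And>x. x \<in> set xs \<Longrightarrow> x \<in> X \<longleftrightarrow> odd_above [l, r] (index_of xs x)"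
proof -
  obtain as zs bs where xs: "xs = as @ zs @ bs" and X: "X = set zs"
    using assms(1) by (auto simp: segment_def sublist_def)
  show ?thesis
  proof (rule that[of "length as" "length as + length zs"])
    fix x assume "x \<in> set xs"
    then show "x \<in> X \<longleftrightarrow> odd_above [length as, length as + length zs] (index_of xs x)"
      using assms(2) index_of_less_length[of x as] index_of_less_length[of x zs]
      by (auto simp: xs X index_of_append)
  qed (simp_all add: xs)
qed

text \<open>Two thresholds for each of two segments, and one to complement their symmetric difference.\<close>

definition threshold_coded :: "'a set \<Rightarrow> 'a list \<Rightarrow> 'a set \<Rightarrow> bool" where
  "threshold_coded X xs A \<longleftrightarrow> (\<exists>ts. length ts = 5 \<and> (\<forall>t\<in>set ts. t \<le> length xs) \<and>
     (\<forall>x\<in>X. x \<in> A \<longleftrightarrow> odd_above ts (index_of xs x)))"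

lemma threshold_coded_sym_diff:
  assumes "distinct xs" "X \<subseteq> set xs" "segment xs P" "segment xs Q"
    and A: "X \<inter> A = sym_diff P Q \<or> X - A = sym_diff P Q"
  shows "threshold_coded X xs A"
proof -
  obtain l1 r1 where P: "l1 \<le> length xs" "r1 \<le> length xs"
    "\<And>x. x \<in> set xs \<Longrightarrow> x \<in> P \<longleftrightarrow> odd_above [l1, r1] (index_of xs x)"
    using segment_thresholds[OF assms(3,1)] by blast
  obtain l2 r2 where Q: "l2 \<le> length xs" "r2 \<le> length xs"
    "\<And>x. x \<in> set xs \<Longrightarrow> x \<in> Q \<longleftrightarrow> odd_above [l2, r2] (index_of xs x)"
    using segment_thresholds[OF assms(4,1)] by blast
  define flip where "flip = (if X \<inter> A = sym_diff P Q then 0 else length xs)"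
  have "x \<in> A \<longleftrightarrow> odd_above [l1, r1, l2, r2, flip] (index_of xs x)" if "x \<in> X" for x
  proof -
    have x: "x \<in> set xs" using that assms(2) by blast
    have "x \<in> A \<longleftrightarrow> ((x \<in> P) \<noteq> (x \<in> Q)) \<noteq> odd_above [flip] (index_of xs x)"
      using A that index_of_less_length[OF x] by (auto simp: flip_def)
    then show ?thesis
      unfolding P(3)[OF x] Q(3)[OF x] by auto
  qed
  moreover have "flip \<le> length xs" by (simp add: flip_def)
  ultimately show ?thesis
    unfolding threshold_coded_def using P(1,2) Q(1,2)
    by (intro exI[of _ "[l1, r1, l2, r2, flip]"]) simp
qed

type_synonym cut_code = "bool list \<times> nat list"

definition code_member :: "cut_code \<Rightarrow> nat \<Rightarrow> bool" where
  "code_member code i =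
     (if i < length (fst code) then fst code ! i else odd_above (snd code) i)"

definition decode :: "'a list \<Rightarrow> cut_code \<Rightarrow> 'a set" where
  "decode xs code = {x \<in> set xs. code_member code (index_of xs x)}"

definition valid_code :: "nat \<Rightarrow> cut_code \<Rightarrow> bool" where
  "valid_code k code \<longleftrightarrow> length (snd code) = 5 \<and> (\<forall>t\<in>set (snd code). t \<le> k)"

lemma threshold_coded_decode:
  assumes "threshold_coded (set ys) (xs @ ys) C" "C \<subseteq> set (xs @ ys)"
  shows "\<exists>code. valid_code (length (xs @ ys)) code \<and> length (fst code) = length xs \<and>
    decode (xs @ ys) code = C"
proof -
  obtain ts where ts: "length ts = 5" "\<forall>t\<in>set ts. t \<le> length (xs @ ys)"
    "\<And>x. x \<in> set ys \<Longrightarrow> x \<in> C \<longleftrightarrow> odd_above ts (index_of (xs @ ys) x)"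
    using assms(1) unfolding threshold_coded_def by blast
  define code where "code = (map (\<lambda>x. x \<in> C) xs, ts)"
  have "code_member code (index_of (xs @ ys) x) \<longleftrightarrow> x \<in> C" if "x \<in> set (xs @ ys)" for x
  proof (cases "x \<in> set xs")
    case True
    then show ?thesis
      by (simp add: code_def code_member_def index_of_append index_of_less_length nth_index_of)
  next
    case False
    then show ?thesis
      using that ts(3)[of x] by (simp add: code_def code_member_def index_of_append)
  qed
  then have "decode (xs @ ys) code = C" using assms(2) by (auto simp: decode_def)
  moreover have "valid_code (length (xs @ ys)) code" "length (fst code) = length xs"
    using ts(1,2) by (simp_all add: valid_code_def code_def)
  ultimately show ?thesis by blast
qed

lemma threshold_coded_codes:
  assumes "finite F"
    and "\<And>C. C \<in> F \<Longrightarrow> threshold_coded (set ys) (xs @ ys) C \<and> C \<subseteq> set (xs @ ys)"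
  obtains codes where "length codes = card F" "decode (xs @ ys) ` set codes = F"
    "\<forall>code\<in>set codes. valid_code (length (xs @ ys)) code"
    "(\<Sum>code\<leftarrow>codes. length (fst code)) = card F * length xs"
proof -
  have "\<exists>code. (valid_code (length (xs @ ys)) code \<and> length (fst code) = length xs) \<and>
      decode (xs @ ys) code = C" if "C \<in> F" for C
    using threshold_coded_decode[of ys xs C] assms(2)[OF that] by simp
  from finite_preimage_list[OF assms(1) this] obtain codes where "length codes = card F"
    "decode (xs @ ys) ` set codes = F"
    "\<forall>code\<in>set codes. valid_code (length (xs @ ys)) code \<and> length (fst code) = length xs"
    by blast
  then show ?thesis
    by (intro that[of codes]) (simp_all add: sum_list_triv cong: map_cong)
qed

lemma threshold_coded_empty: "threshold_coded {} xs C"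
  by (auto simp: threshold_coded_def intro: exI[of _ "replicate 5 0"])

section \<open>Steiner cuts of capacity one above the minimum\<close>

locale steiner_multigraph =
  fixes V :: "'a set" and E :: "'a set multiset" and S :: "'a set"
  assumes multigraph: "multigraph V E" and S_subset: "S \<subseteq> V" and card_S: "2 \<le> card S"
begin

abbreviation cap :: "'a set \<Rightarrow> nat" where "cap \<equiv> capacity V E"

abbreviation mincap :: nat where "mincap \<equiv> mincut_capacity V E S"

definition cuts :: "nat \<Rightarrow> 'a set set" where
  "cuts k = {C. steiner_cut V S C \<and> cap C = k}"

definition composite :: "'a set \<Rightarrow> bool" where
  "composite A \<longleftrightarrow> (\<exists>M\<in>cuts mincap. \<exists>N\<in>cuts mincap. M \<inter> N = {} \<and> M \<union> N \<in> {A, V - A})"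

lemma finite_V: "finite V"
  using multigraph by (simp add: multigraph_def)

lemma finite_S: "finite S"
  using S_subset finite_V by (rule finite_subset)

lemma card_S_le: "card S \<le> card V"
  using finite_V S_subset by (rule card_mono)

lemma card_nonterminals: "card (V - S) = card V - card S"
  using finite_S S_subset by (rule card_Diff_subset)

lemma steiner_cut_iff: "steiner_cut V S C \<longleftrightarrow> C \<subseteq> V \<and> S \<inter> C \<noteq> {} \<and> S - C \<noteq> {}"
  using S_subset by (auto simp: steiner_cut_def cut_def)

lemma finite_steiner_cuts: "finite {C. steiner_cut V S C}"
  by (rule finite_subset[of _ "Pow V"]) (auto simp: steiner_cut_iff finite_V)

lemma finite_cuts: "finite (cuts k)"
  by (rule finite_subset[OF _ finite_steiner_cuts]) (auto simp: cuts_def)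

lemma mincap_le: "steiner_cut V S C \<Longrightarrow> mincap \<le> cap C"
  unfolding mincut_capacity_def using finite_steiner_cuts by (intro Min_le) auto

lemma cuts_subset: "A \<in> cuts k \<Longrightarrow> A \<subseteq> V"
  by (simp add: cuts_def steiner_cut_iff)

lemma cuts_complement: "A \<in> cuts k \<Longrightarrow> V - A \<in> cuts k"
  using S_subset by (auto simp: cuts_def steiner_cut_iff capacity_complement)

lemma steiner_cut_corners:
  assumes "crosses S A B" "A \<subseteq> V" "B \<subseteq> V"
  shows "steiner_cut V S (A \<inter> B)" "steiner_cut V S (A \<union> B)"
    "steiner_cut V S (A - B)" "steiner_cut V S (B - A)"
  using assms unfolding crosses_def steiner_cut_iff by blast+

lemma even_cap_disjoint_Un:
  assumes "A \<in> cuts k" "B \<in> cuts k" "A \<inter> B = {}"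
  shows "even (cap (A \<union> B))"
proof -
  have "2 * k = cap (A \<union> B) + 2 * size (edges_between E (A - B) (B - A))"
    using capacity_Int_Un[OF multigraph, of A B] assms by (simp add: cuts_def capacity_def)
  then show ?thesis by presburger
qed

lemma composite_imp_odd:
  assumes "A \<in> cuts (mincap + 1)" "composite A"
  shows "odd mincap"
proof -
  obtain M N where MN: "M \<in> cuts mincap" "N \<in> cuts mincap" "M \<inter> N = {}" "M \<union> N \<in> {A, V - A}"
    using assms(2) by (auto simp: composite_def)
  have "cap (M \<union> N) = mincap + 1"
    using MN(4) assms(1) cuts_complement[OF assms(1)] by (auto simp: cuts_def)
  then show ?thesis using even_cap_disjoint_Un[OF MN(1-3)] by simp
qed

text \<open>A corner from each diagonal: two such corners are adjacent, so their union is one of the two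
  crossing cuts or its complement.\<close>

lemma disjoint_corner_cuts:
  assumes "A \<subseteq> V" "B \<subseteq> V" "crosses S A B"
    and diagonals: "k \<in> {cap (A \<inter> B), cap (A \<union> B)}" "k \<in> {cap (A - B), cap (B - A)}"
  obtains P Q where "P \<in> cuts k" "Q \<in> cuts k" "P \<inter> Q = {}"
    "P \<union> Q \<in> {A, V - A, B, V - B}"
proof -
  note steiner = steiner_cut_corners[OF assms(3,1,2)]
  obtain P where P: "P \<in> cuts k" "P = A \<inter> B \<or> P = V - (A \<union> B)"
  proof (cases "cap (A \<inter> B) = k")
    case True
    then show ?thesis using that[of "A \<inter> B"] steiner(1) by (simp add: cuts_def)
  next
    case False
    then have "A \<union> B \<in> cuts k" using diagonals(1) steiner(2) by (simp add: cuts_def)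
    then show ?thesis using that[of "V - (A \<union> B)"] cuts_complement by blast
  qed
  obtain Q where Q: "Q \<in> cuts k" "Q = A - B \<or> Q = B - A"
    using diagonals(2) steiner(3,4) by (auto simp: cuts_def)
  have "P \<inter> Q = {}"
    using P(2) Q(2) by blast
  moreover have "P \<union> Q \<in> {A, V - A, B, V - B}"
    using P(2) Q(2) assms(1,2) by (elim disjE) auto
  ultimately show ?thesis using that P(1) Q(1) by blast
qed

lemma odd_mincut_not_crosses:
  assumes "odd mincap" "A \<in> cuts mincap \<or> A \<in> cuts (mincap + 1) \<and> \<not> composite A"
    and B: "B \<in> cuts mincap"
  shows "\<not> crosses S A B"
proof
  assume crosses: "crosses S A B"
  have sub: "A \<subseteq> V" "B \<subseteq> V" using assms cuts_subset by blast+
  have caps: "cap A = mincap \<or> cap A = mincap + 1" "cap B = mincap"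
    using assms by (auto simp: cuts_def)
  note corners = steiner_cut_corners[OF crosses sub, THEN mincap_le]
  have "mincap \<in> {cap (A \<inter> B), cap (A \<union> B)}"
    using capacity_Int_Un[OF multigraph, of A B] corners(1,2) caps by simp linarith
  moreover have "mincap \<in> {cap (A - B), cap (B - A)}"
    using capacity_Diff_Diff[OF multigraph sub] corners(3,4) caps by simp linarith
  ultimately obtain P Q where PQ: "P \<in> cuts mincap" "Q \<in> cuts mincap" "P \<inter> Q = {}"
      "P \<union> Q \<in> {A, V - A, B, V - B}"
    using disjoint_corner_cuts[OF sub crosses] by blast
  have "cap (P \<union> Q) \<noteq> mincap"
    using even_cap_disjoint_Un[OF PQ(1-3)] assms(1) by auto
  then have "P \<union> Q \<in> {A, V - A}" "cap A \<noteq> mincap"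
    using PQ(4) caps(2) sub capacity_complement by (metis insertE empty_iff insertCI)+
  with PQ(1-3) assms(2) show False
    by (auto simp: composite_def cuts_def)
qed

lemma noncomposite_uncross:
  assumes "A \<in> cuts (mincap + 1)" "B \<in> cuts (mincap + 1)" "\<not> composite A" "\<not> composite B"
    and crosses: "crosses S A B"
  shows "A \<inter> B \<in> cuts (mincap + 1) \<and> A \<union> B \<in> cuts (mincap + 1) \<or>
    A - B \<in> cuts (mincap + 1) \<and> B - A \<in> cuts (mincap + 1)"
proof -
  have sub: "A \<subseteq> V" "B \<subseteq> V" using assms cuts_subset by blast+
  note steiner = steiner_cut_corners[OF crosses sub]
  have "mincap \<notin> {cap (A \<inter> B), cap (A \<union> B)} \<or> mincap \<notin> {cap (A - B), cap (B - A)}"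
  proof (rule ccontr)
    assume "\<not> ?thesis"
    then obtain P Q where "P \<in> cuts mincap" "Q \<in> cuts mincap" "P \<inter> Q = {}"
        "P \<union> Q \<in> {A, V - A, B, V - B}"
      using disjoint_corner_cuts[OF sub crosses] by blast
    then show False using assms(3,4) unfolding composite_def by blast
  qed
  moreover have "cap A = mincap + 1" "cap B = mincap + 1"
    using assms by (auto simp: cuts_def)
  ultimately have "cap (A \<inter> B) = mincap + 1 \<and> cap (A \<union> B) = mincap + 1 \<or>
      cap (A - B) = mincap + 1 \<and> cap (B - A) = mincap + 1"
    using capacity_Int_Un[OF multigraph, of A B] capacity_Diff_Diff[OF multigraph sub]
      steiner[THEN mincap_le] by simp linarith
  then show ?thesis using steiner by (auto simp: cuts_def)
qed

lemma separated_by_cross_free_or_composite: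
  assumes K: "K \<subseteq> {A \<in> cuts (mincap + 1). \<not> composite A}" "cross_free S K"
    and maximal: "\<And>A. A \<in> cuts (mincap + 1) \<Longrightarrow> \<not> composite A \<Longrightarrow> (\<forall>B\<in>K. \<not> crosses S A B) \<Longrightarrow> A \<in> K"
    and "A \<in> cuts (mincap + 1)" "separates A u v"
  shows "\<exists>B\<in>K \<union> {B \<in> cuts (mincap + 1). composite B}. separates B u v"
  using assms(4,5)
proof (induction "card {B \<in> K. crosses S A B}" arbitrary: A rule: less_induct)
  case less
  have "finite K"
    by (rule finite_subset[OF K(1)]) (simp add: finite_cuts)
  show ?case
  proof (cases "composite A \<or> A \<in> K")
    case True
    then show ?thesis using less.prems by blast
  next
    case False
    then obtain B where B: "B \<in> K" "crosses S A B"
      using maximal less.prems(1) by blast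
    have corner: ?thesis
      if "Y \<in> {A \<inter> B, A \<union> B, A - B, B - A}" "Y \<in> cuts (mincap + 1)" "separates Y u v" for Y
      using less.hyps[OF card_crossing_corner_less[OF \<open>finite K\<close> K(2) B that(1)] that(2,3)] .
    have "A \<inter> B \<in> cuts (mincap + 1) \<and> A \<union> B \<in> cuts (mincap + 1) \<or>
        A - B \<in> cuts (mincap + 1) \<and> B - A \<in> cuts (mincap + 1)"
      using noncomposite_uncross[OF less.prems(1) _ _ _ B(2)] K(1) B(1) False by blast
    moreover have "separates (A \<inter> B) u v \<or> separates (A \<union> B) u v \<or> separates B u v"
      "separates (A - B) u v \<or> separates (B - A) u v \<or> separates B u v"
      using less.prems(2) unfolding separates_def by blast+
    ultimately show ?thesis
      using corner B(1) by blast
  qed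
qed

definition components :: "'a set set \<Rightarrow> 'a set set" where
  "components K = insert {} (K \<union> (if odd mincap then cuts mincap else {}))"

lemma cross_free_components:
  assumes "K \<subseteq> {A \<in> cuts (mincap + 1). \<not> composite A}" "cross_free S K"
  shows "cross_free S (components K)"
proof -
  have "\<not> crosses S A B" "\<not> crosses S B A"
    if "odd mincap" "A \<in> K \<union> cuts mincap" "B \<in> cuts mincap" for A B
    using odd_mincut_not_crosses[OF that(1) _ that(3), of A] that(2) assms(1) crosses_commute[of S]
    by blast+
  moreover have "\<not> crosses S {} A" "\<not> crosses S A {}" for A
    by (simp_all add: crosses_def)
  ultimately show ?thesis
    using assms(2) unfolding components_def pairwise_insert by (auto simp: pairwise_def)
qed

lemma sym_diff_components:
  assumes "A \<in> K \<or> A \<in> cuts (mincap + 1) \<and> composite A"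
  shows "\<exists>M\<in>components K. \<exists>N\<in>components K. sym_diff M N \<in> {A, V - A}"
  using assms
proof
  assume "A \<in> K"
  then show ?thesis
    by (intro bexI[of _ A] bexI[of _ "{}"]) (auto simp: components_def)
next
  assume "A \<in> cuts (mincap + 1) \<and> composite A"
  then have "composite A" "cuts mincap \<subseteq> components K"
    using composite_imp_odd[of A] by (auto simp: components_def)
  then obtain M N where "M \<in> components K" "N \<in> components K" "M \<inter> N = {}" "M \<union> N \<in> {A, V - A}"
    unfolding composite_def by blast
  moreover from \<open>M \<inter> N = {}\<close> have "sym_diff M N = M \<union> N" by blast
  ultimately show ?thesis by metis
qed

lemma cross_free_separators:
  obtains L where "cross_free S L"
    "\<And>A u v. A \<in> cuts (mincap + 1) \<Longrightarrow> separates A u v \<Longrightarrow>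
       \<exists>B\<in>cuts (mincap + 1). separates B u v \<and> (\<exists>M\<in>L. \<exists>N\<in>L. sym_diff M N \<in> {B, V - B})"
proof -
  let ?N = "{A \<in> cuts (mincap + 1). \<not> composite A}"
  have "finite ?N" by (simp add: finite_cuts)
  moreover have "symp (\<lambda>A B. \<not> crosses S A B)"
    by (simp add: symp_def crosses_commute)
  ultimately obtain K where K: "K \<subseteq> ?N" "cross_free S K"
    and maximal: "\<And>A. A \<in> ?N \<Longrightarrow> (\<forall>B\<in>K. \<not> crosses S A B) \<Longrightarrow> A \<in> K"
    by (rule finite_maximal_pairwise) blast
  show ?thesis
  proof (rule that[OF cross_free_components[OF K]])
    fix A u v assume "A \<in> cuts (mincap + 1)" "separates A u v"
    then obtain B where B: "B \<in> K \<or> B \<in> cuts (mincap + 1) \<and> composite B" "separates B u v"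
      using separated_by_cross_free_or_composite[OF K, of A u v] maximal by blast
    moreover have "B \<in> cuts (mincap + 1)" using B(1) K(1) by blast
    ultimately show "\<exists>B\<in>cuts (mincap + 1). separates B u v \<and>
        (\<exists>M\<in>components K. \<exists>N\<in>components K. sym_diff M N \<in> {B, V - B})"
      using sym_diff_components[OF B(1)] by blast
  qed
qed

lemma threshold_coded_separators:
  obtains ns ss where "distinct (ns @ ss)" "set ns = V - S" "set ss = S"
    "resolves {B \<in> cuts (mincap + 1). threshold_coded S (ns @ ss) B} (cuts (mincap + 1)) V"
proof -
  obtain L where L: "cross_free S L"
    and separators: "\<And>A u v. A \<in> cuts (mincap + 1) \<Longrightarrow> separates A u v \<Longrightarrow>
      \<exists>B\<in>cuts (mincap + 1). separates B u v \<and> (\<exists>M\<in>L. \<exists>N\<in>L. sym_diff M N \<in> {B, V - B})"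
    using cross_free_separators by blast
  have "S \<noteq> {}" using card_S by auto
  from cross_free_segments[OF finite_S this L] obtain ss where ss: "distinct ss" "set ss = S"
    and segments: "\<And>A. A \<in> L \<Longrightarrow> segment ss (S \<inter> A) \<or> segment ss (S - A)"
    by blast
  obtain ns where ns: "distinct ns" "set ns = V - S"
    using finite_distinct_list finite_V by blast
  have coded: "threshold_coded S (ns @ ss) B"
    if MN: "M \<in> L" "N \<in> L" "sym_diff M N \<in> {B, V - B}" for B M N
  proof -
    obtain P Q where P: "segment ss P" "P = S \<inter> M \<or> P = S - M"
      and Q: "segment ss Q" "Q = S \<inter> N \<or> Q = S - N"
      using segments[OF MN(1)] segments[OF MN(2)] by blast
    show ?thesis
    proof (rule threshold_coded_sym_diff)
      show "segment (ns @ ss) P" "segment (ns @ ss) Q"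
        using P(1) Q(1) by (simp_all add: segment_append)
      have "S \<inter> B = S \<inter> sym_diff M N \<or> S - B = S \<inter> sym_diff M N"
        using MN(3) S_subset by blast
      moreover have "S \<inter> sym_diff M N = sym_diff P Q \<or> S - sym_diff M N = sym_diff P Q"
        using P(2) Q(2) by (elim disjE) (simp_all, blast+)
      ultimately show "S \<inter> B = sym_diff P Q \<or> S - B = sym_diff P Q"
        by blast
    qed (use ss ns in auto)
  qed
  have "resolves {B \<in> cuts (mincap + 1). threshold_coded S (ns @ ss) B} (cuts (mincap + 1)) V"
    unfolding resolves_def inseparable_def using separators coded by blast
  moreover have "distinct (ns @ ss)" using ss ns by auto
  ultimately show ?thesis using that ss(2) ns(2) by blast
qed

lemma resolving_family:
  obtains ns ss F G where "distinct (ns @ ss)" "set ns = V - S" "set ss = S"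
    "F \<subseteq> {B \<in> cuts (mincap + 1). threshold_coded S (ns @ ss) B}" "finite F" "card F \<le> card S"
    "G \<subseteq> cuts (mincap + 1)" "finite G" "card G \<le> card (V - S)"
    "resolves (F \<union> G) (cuts (mincap + 1)) V"
proof -
  obtain ns ss where lists: "distinct (ns @ ss)" "set ns = V - S" "set ss = S"
    and resolves: "resolves {B \<in> cuts (mincap + 1). threshold_coded S (ns @ ss) B}
      (cuts (mincap + 1)) V" (is "resolves ?T _ _")
    by (rule threshold_coded_separators)
  obtain F where F: "F \<subseteq> ?T" "finite F" "card F \<le> card S" "resolves F ?T S"
    using resolves_extend[OF finite_S, of "{}" ?T "{}"] by (auto simp: resolves_def)
  have "resolves F (cuts (mincap + 1)) S"
    using F(4) resolves S_subset unfolding resolves_def by blast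
  moreover have V: "S \<union> (V - S) = V" using S_subset by blast
  ultimately obtain G where "G \<subseteq> cuts (mincap + 1)" "finite G" "card G \<le> card (V - S)"
      "resolves (F \<union> G) (cuts (mincap + 1)) V"
    using resolves_extend[of "V - S" F "cuts (mincap + 1)" S, unfolded V] finite_V by blast
  from that[OF lists F(1-3) this] show ?thesis .
qed

lemma resolving_codes:
  obtains xs codes where "distinct xs" "set xs = V" "length codes \<le> card V"
    "(\<Sum>code\<leftarrow>codes. length (fst code)) \<le> 2 * (card V * card (V - S))"
    "\<forall>code\<in>set codes. valid_code (card V) code"
    "decode xs ` set codes \<subseteq> cuts (mincap + 1)"
    "resolves (decode xs ` set codes) (cuts (mincap + 1)) V"
proof -
  obtain ns ss F G where lists: "distinct (ns @ ss)" "set ns = V - S" "set ss = S"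
    and F: "F \<subseteq> {B \<in> cuts (mincap + 1). threshold_coded S (ns @ ss) B}" "finite F" "card F \<le> card S"
    and G: "G \<subseteq> cuts (mincap + 1)" "finite G" "card G \<le> card (V - S)"
    and resolves: "resolves (F \<union> G) (cuts (mincap + 1)) V"
    by (rule resolving_family)
  define xs where "xs = ns @ ss"
  have xs: "distinct xs" "set xs = V"
    using lists S_subset by (auto simp: xs_def)
  have lengths: "length xs = card V" "length ns = card (V - S)"
    using distinct_card[OF xs(1)] distinct_card[of ns] xs(2) lists by simp_all
  have "threshold_coded (set ss) (ns @ ss) C \<and> C \<subseteq> set (ns @ ss)" if "C \<in> F" for C
    using that F(1) cuts_subset xs(2) lists(3) by (auto simp: xs_def)
  from threshold_coded_codes[OF F(2) this] obtain codes_F where codes_F: "length codes_F = card F"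
    "decode xs ` set codes_F = F" "\<forall>code\<in>set codes_F. valid_code (card V) code"
    "(\<Sum>code\<leftarrow>codes_F. length (fst code)) = card F * card (V - S)"
    unfolding xs_def[symmetric] lengths by metis
  have "threshold_coded (set []) (xs @ []) C \<and> C \<subseteq> set (xs @ [])" if "C \<in> G" for C
    using that G(1) cuts_subset[of C] xs(2) threshold_coded_empty[of xs C] by auto
  from threshold_coded_codes[OF G(2) this] obtain codes_G where codes_G: "length codes_G = card G"
    "decode xs ` set codes_G = G" "\<forall>code\<in>set codes_G. valid_code (card V) code"
    "(\<Sum>code\<leftarrow>codes_G. length (fst code)) = card G * card V"
    unfolding append_Nil2 lengths by metis
  have "card F * card (V - S) \<le> card V * card (V - S)"
    using F(3) card_S_le by (intro mult_le_mono1) simp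
  moreover have "card G * card V \<le> card V * card (V - S)"
    using mult_le_mono2[OF G(3), of "card V"] by (simp only: mult.commute)
  ultimately have "(\<Sum>code\<leftarrow>codes_F @ codes_G. length (fst code)) \<le> 2 * (card V * card (V - S))"
    unfolding map_append sum_list_append codes_F(4) codes_G(4) by linarith
  moreover have "length (codes_F @ codes_G) \<le> card V"
    using codes_F(1) codes_G(1) F(3) G(3) card_S_le by (simp add: card_nonterminals)
  moreover have "decode xs ` set (codes_F @ codes_G) = F \<union> G"
    using codes_F(2) codes_G(2) by (simp add: image_Un)
  moreover have "F \<union> G \<subseteq> cuts (mincap + 1)"
    using F(1) G(1) by blast
  moreover have "\<forall>code\<in>set (codes_F @ codes_G). valid_code (card V) code"
    using codes_F(3) codes_G(3) by auto
  ultimately show ?thesis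
    using resolves by (intro that[OF xs, of "codes_F @ codes_G"]) (simp_all only:)
qed

lemma least_separating_steiner_cut_iff:
  "(\<exists>C. least_separating_steiner_cut V E S u v C \<and> cap C = mincap + 1) \<longleftrightarrow>
   inseparable (cuts mincap) u v \<and> \<not> inseparable (cuts (mincap + 1)) u v" (is "?L \<longleftrightarrow> ?R")
proof
  assume ?L
  then obtain C where C: "steiner_cut V S C" "separates C u v" "cap C = mincap + 1"
    "\<And>D. steiner_cut V S D \<Longrightarrow> separates D u v \<Longrightarrow> \<not> cap D < cap C"
    by (auto simp: least_separating_steiner_cut_def is_arg_min_def)
  then show ?R
    by (fastforce simp: inseparable_def cuts_def)
next
  assume R: ?R
  then obtain C where C: "steiner_cut V S C" "separates C u v" "cap C = mincap + 1"
    by (auto simp: inseparable_def cuts_def)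
  have "\<not> cap D < cap C" if "steiner_cut V S D" "separates D u v" for D
  proof -
    have "cap D \<noteq> mincap" using R that by (auto simp: inseparable_def cuts_def)
    then show ?thesis using mincap_le[OF that(1)] C(3) by linarith
  qed
  then show ?L using C by (auto simp: least_separating_steiner_cut_def is_arg_min_def)
qed

end

section \<open>Running programs\<close>

primrec loop_free :: "prog \<Rightarrow> bool" where
  "loop_free Skip \<longleftrightarrow> True"
| "loop_free (Const r k) \<longleftrightarrow> True"
| "loop_free (Bin f r a b) \<longleftrightarrow> True"
| "loop_free (Load r a) \<longleftrightarrow> True"
| "loop_free (Store a r) \<longleftrightarrow> True"
| "loop_free (Emit r) \<longleftrightarrow> True"
| "loop_free (Seq P Q) \<longleftrightarrow> loop_free P \<and> loop_free Q"
| "loop_free (Cond r P Q) \<longleftrightarrow> loop_free P \<and> loop_free Q"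
| "loop_free (While r P) \<longleftrightarrow> False"

text \<open>The values of \<open>cost\<close> and \<open>run\<close> at loops are junk.\<close>

primrec cost :: "prog \<Rightarrow> nat" where
  "cost Skip = 1"
| "cost (Const r k) = 1"
| "cost (Bin f r a b) = 1"
| "cost (Load r a) = 1"
| "cost (Store a r) = 1"
| "cost (Emit r) = 1"
| "cost (Seq P Q) = cost P + cost Q"
| "cost (Cond r P Q) = max (cost P) (cost Q) + 1"
| "cost (While r P) = 0"

primrec run :: "nat \<Rightarrow> prog \<Rightarrow> ram \<Rightarrow> ram" where
  "run w Skip s = s"
| "run w (Const r k) s = s\<lparr>regs := (regs s)(r := k mod 2 ^ w)\<rparr>"
| "run w (Bin f r a b) s = s\<lparr>regs := (regs s)(r := binop_val w f (regs s a) (regs s b))\<rparr>"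
| "run w (Load r a) s = s\<lparr>regs := (regs s)(r := mem s (regs s a))\<rparr>"
| "run w (Store a r) s = s\<lparr>mem := (mem s)(regs s a := regs s r)\<rparr>"
| "run w (Emit r) s = s\<lparr>emitted := emitted s @ [regs s r]\<rparr>"
| "run w (Seq P Q) s = run w Q (run w P s)"
| "run w (Cond r P Q) s = (if regs s r \<noteq> 0 then run w P s else run w Q s)"
| "run w (While r P) s = s"

lemma exec_run: "loop_free P \<Longrightarrow> \<exists>t\<le>cost P. exec w P s t (run w P s)"
proof (induction P arbitrary: s)
  case (Seq P Q)
  then obtain t1 t2 where "t1 \<le> cost P" "exec w P s t1 (run w P s)"
    "t2 \<le> cost Q" "exec w Q (run w P s) t2 (run w Q (run w P s))"
    by (metis loop_free.simps(7))
  then show ?case by (intro exI[of _ "t1 + t2"]) (auto intro: exec.Seq)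
next
  case (Cond r P Q)
  then obtain t1 t2 where t: "t1 \<le> cost P" "exec w P s t1 (run w P s)"
    "t2 \<le> cost Q" "exec w Q s t2 (run w Q s)"
    by (metis loop_free.simps(8))
  show ?case
  proof (cases "regs s r = 0")
    case True
    then show ?thesis
      using t exec.CondFalse[OF True t(4), of P] by (intro exI[of _ "t2 + 1"]) auto
  next
    case False
    then show ?thesis
      using t exec.CondTrue[OF False t(2), of Q] by (intro exI[of _ "t1 + 1"]) auto
  qed
qed (auto intro!: exI[of _ "Suc 0"] exec.intros(1-6)[unfolded One_nat_def])

lemma exec_While_invariant:
  assumes "loop_free B" "I 0 s"
    and step: "\<And>i s. i < k \<Longrightarrow> I i s \<Longrightarrow> regs s r \<noteq> 0 \<and> I (Suc i) (run w B s)"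
    and exit: "\<And>s. I k s \<Longrightarrow> regs s r = 0"
  shows "\<exists>t s'. exec w (While r B) s t s' \<and> t \<le> k * (cost B + 1) + 1 \<and> I k s'"
  using assms(2-)
proof (induction k arbitrary: I s)
  case 0
  then show ?case using exec.WhileFalse[of s r w B] by (intro exI[of _ 1] exI[of _ s]) simp
next
  case (Suc k)
  have s: "regs s r \<noteq> 0" "I (Suc 0) (run w B s)"
    using Suc.prems(1,2) by blast+
  obtain t1 where t1: "t1 \<le> cost B" "exec w B s t1 (run w B s)"
    using exec_run[OF assms(1)] by blast
  obtain t2 s' where t2: "exec w (While r B) (run w B s) t2 s'" "t2 \<le> k * (cost B + 1) + 1"
    "I (Suc k) s'"
    using Suc.IH[of "\<lambda>i. I (Suc i)", OF s(2)] Suc.prems(2,3) by blast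
  show ?case
    using exec.WhileTrue[OF s(1) t1(2) t2(1)] t1(1) t2(2,3)
    by (intro exI[of _ "t1 + t2 + 1"] exI[of _ s']) simp
qed

primrec block :: "prog list \<Rightarrow> prog" where
  "block [] = Skip"
| "block (P # Ps) = Seq P (block Ps)"

definition keeps :: "nat \<Rightarrow> ram \<Rightarrow> ram \<Rightarrow> bool" where
  "keeps k s s' \<longleftrightarrow> (\<forall>r<k. regs s' r = regs s r) \<and> mem s' = mem s"

lemma answers_query_mono:
  assumes "answers_query w P D x y T Q" "\<And>out. Q out \<Longrightarrow> R out"
  shows "answers_query w P D x y T R"
  using assms unfolding answers_query_def by blast

section \<open>The query programs\<close>

text \<open>Memory consists of records of eight cells, followed by rows of bits of variable length. Cell
  \<open>0\<close> holds \<open>n\<close>; the record of vertex \<open>x\<close> starts at \<open>8 * x + 8\<close> and holds its column and its class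
  labels for the capacities \<open>\<lambda>\<close> and \<open>\<lambda> + 1\<close>; the records of cuts follow and hold the length of the
  row, its address, and the thresholds.

  Registers: \<open>0\<close> and \<open>1\<close> hold the query, \<open>2\<close> and \<open>3\<close> the constants \<open>8\<close> and \<open>1\<close>, \<open>4\<close> holds \<open>n\<close>, \<open>5\<close>
  the address of a cut record, \<open>6\<close> a vertex, \<open>8\<close> its membership flag, \<open>15\<close> the loop condition.
  \<open>Bin Or r a a\<close> copies \<open>a\<close> to \<open>r\<close>.\<close>

definition stored_flag :: "(nat \<Rightarrow> nat) \<Rightarrow> nat \<Rightarrow> nat \<Rightarrow> nat" where
  "stored_flag m x c =
     (if m (8 * x + 8) < m c then m (m (c + 1) + m (8 * x + 8))
      else of_bool (odd_above (map m [c + 2..<c + 7]) (m (8 * x + 8))))"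

definition parity_step :: prog where
  "parity_step = block [Bin Add 12 12 3, Load 10 12, Bin Less 10 9 10, Bin Xor 8 8 10]"

definition flag_prog :: prog where
  "flag_prog = block
    [Bin Mul 9 2 6, Bin Add 9 9 2, Load 9 9, Load 10 5, Bin Less 11 9 10, Bin Add 12 5 3,
     Cond 11
       (block [Load 10 12, Bin Add 10 10 9, Load 8 10])
       (block [Const 8 0, block (replicate 5 parity_step)])]"

definition scan_body :: prog where
  "scan_body = block
    [Bin Add 5 5 2, Bin Or 6 0 0, flag_prog, Bin Or 7 8 8, Bin Or 6 1 1, flag_prog,
     Bin Equal 15 7 8]"

definition emit_body :: prog where
  "emit_body = block [flag_prog, Cond 8 (Emit 6) Skip, Bin Add 6 6 3, Bin Less 15 6 4]"

definition init_prog :: prog where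
  "init_prog = block [Const 2 8, Const 3 1, Const 4 0, Load 4 4, Bin Mul 5 2 4, Const 15 1]"

definition report_prog :: prog where
  "report_prog = block
    [init_prog, While 15 scan_body, Const 6 0, Const 15 1, While 15 emit_body]"

definition decide_prog :: prog where
  "decide_prog = block
    [Const 2 8, Const 3 1, Bin Mul 0 2 0, Bin Mul 1 2 1, Bin Add 0 0 2, Bin Add 1 1 2,
     Bin Add 0 0 3, Bin Add 1 1 3, Load 5 0, Load 6 1, Bin Equal 5 5 6,
     Bin Add 0 0 3, Bin Add 1 1 3, Load 6 0, Load 7 1, Bin Equal 6 6 7, Bin Less 5 6 5, Emit 5]"

lemma xor_of_bool: "xor (of_bool p) (of_bool q :: nat) = of_bool (p \<noteq> q)"
  by (cases p; cases q) simp_all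

lemma run_parity_steps:
  assumes "regs s 3 = 1" "regs s 12 + j < 2 ^ w" "regs s 8 = of_bool b"
    and "s' = run w (block (replicate j parity_step)) s"
  shows "regs s' 8 =
      of_bool (b \<noteq> odd_above (map (mem s) [regs s 12 + 1..<regs s 12 + j + 1]) (regs s 9)) \<and>
    (\<forall>r. r \<notin> {8, 10, 12} \<longrightarrow> regs s' r = regs s r) \<and> mem s' = mem s \<and> emitted s' = emitted s"
  using assms
proof (induction j arbitrary: s b)
  case 0
  then show ?case by simp
next
  case (Suc j)
  let ?s = "run w parity_step s"
  have s: "regs ?s 12 = regs s 12 + 1"
      "regs ?s 8 = of_bool (b \<noteq> (regs s 9 < mem s (regs s 12 + 1)))"
      "\<And>r. r \<notin> {8, 10, 12} \<Longrightarrow> regs ?s r = regs s r" "mem ?s = mem s" "emitted ?s = emitted s"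
    using Suc.prems(1-3) by (simp_all add: parity_step_def xor_of_bool)
  have "regs ?s 3 = 1" "regs ?s 12 + j < 2 ^ w" "s' = run w (block (replicate j parity_step)) ?s"
    using Suc.prems s by simp_all
  note IH = Suc.IH[OF this(1,2) s(2) this(3)]
  have "map (mem s) [regs s 12 + 1..<regs s 12 + Suc j + 1] =
      mem s (regs s 12 + 1) # map (mem s) [regs s 12 + 2..<regs s 12 + j + 2]"
    by (simp add: upt_conv_Cons del: upt_Suc)
  then show ?case
    using IH s by (auto simp del: upt_Suc)
qed

lemma run_flag_prog:
  assumes "regs s 2 = 8" "regs s 3 = 1" "8 * regs s 6 + 8 < 2 ^ w" "regs s 5 + 6 < 2 ^ w"
    "mem s (8 * regs s 6 + 8) < mem s (regs s 5) \<Longrightarrow>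
      mem s (regs s 5 + 1) + mem s (8 * regs s 6 + 8) < 2 ^ w"
  shows "regs (run w flag_prog s) 8 = stored_flag (mem s) (regs s 6) (regs s 5)"
    "keeps 8 s (run w flag_prog s)" "emitted (run w flag_prog s) = emitted s"
proof -
  have "regs (run w flag_prog s) 8 = stored_flag (mem s) (regs s 6) (regs s 5) \<and>
    keeps 8 s (run w flag_prog s) \<and> emitted (run w flag_prog s) = emitted s"
  proof (cases "mem s (8 * regs s 6 + 8) < mem s (regs s 5)")
    case True
    then show ?thesis
      using assms by (simp add: flag_prog_def stored_flag_def keeps_def)
  next
    case False
    let ?read = "block [Bin Mul 9 2 6, Bin Add 9 9 2, Load 9 9, Load 10 5, Bin Less 11 9 10,
      Bin Add 12 5 3, Const 8 0]"
    define s1 where "s1 = run w ?read s"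
    have s1: "regs s1 9 = mem s (8 * regs s 6 + 8)" "regs s1 12 = regs s 5 + 1" "regs s1 8 = 0"
        "keeps 8 s s1" "emitted s1 = emitted s"
      using assms by (simp_all add: s1_def keeps_def)
    have "run w flag_prog s = run w (block (replicate 5 parity_step)) s1"
      using False assms by (simp add: flag_prog_def s1_def)
    from run_parity_steps[OF _ _ _ this, of False] show ?thesis
      using False assms s1 by (simp add: stored_flag_def keeps_def add.commute)
  qed
  then show "regs (run w flag_prog s) 8 = stored_flag (mem s) (regs s 6) (regs s 5)"
    "keeps 8 s (run w flag_prog s)" "emitted (run w flag_prog s) = emitted s"
    by auto
qed

lemma loop_free_flag_prog: "loop_free flag_prog"
  by (simp add: flag_prog_def parity_step_def numeral_eq_Suc)

lemma cost_scan_body: "cost scan_body \<le> 100"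
  by (simp add: scan_body_def flag_prog_def parity_step_def numeral_eq_Suc)

lemma cost_emit_body: "cost emit_body \<le> 50"
  by (simp add: emit_body_def flag_prog_def parity_step_def numeral_eq_Suc)

section \<open>The memory image\<close>

lemma nth_concat_offset:
  assumes "i < length xss" "j < length (xss ! i)"
  shows "sum_list (map length (take i xss)) + j < length (concat xss)"
    "concat xss ! (sum_list (map length (take i xss)) + j) = xss ! i ! j"
proof -
  have "sum_list (map length (take i xss)) + j < length (concat xss) \<and>
    concat xss ! (sum_list (map length (take i xss)) + j) = xss ! i ! j"
    using assms
  proof (induction xss arbitrary: i)
    case (Cons xs xss)
    then show ?case
      by (cases i) (auto simp: nth_append add.assoc)
  qed simp
  then show "sum_list (map length (take i xss)) + j < length (concat xss)"
    "concat xss ! (sum_list (map length (take i xss)) + j) = xss ! i ! j"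
    by auto
qed

lemma sum_list_length_uniform:
  assumes "\<forall>xs\<in>set xss. length xs = k"
  shows "sum_list (map length xss) = k * length xss"
  using assms by (induction xss) simp_all

lemma nth_concat_uniform:
  assumes "\<forall>xs\<in>set xss. length xs = k" "i < length xss" "j < k"
  shows "k * i + j < length (concat xss)" "concat xss ! (k * i + j) = xss ! i ! j"
proof -
  have "\<forall>xs\<in>set (take i xss). length xs = k"
    using assms(1) by (blast dest: in_set_takeD)
  from sum_list_length_uniform[OF this] have "sum_list (map length (take i xss)) = k * i"
    using assms(2) by simp
  then show "k * i + j < length (concat xss)" "concat xss ! (k * i + j) = xss ! i ! j"
    using nth_concat_offset[of i xss j] assms by simp_all
qed

locale cut_table =
  fixes n :: nat and column label0 label1 :: "nat \<Rightarrow> nat" and codes :: "cut_code list"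
  assumes valid_codes: "code \<in> set codes \<Longrightarrow> valid_code n code"
begin

definition rows :: "nat list list" where
  "rows = map (\<lambda>code. map of_bool (fst code)) codes"

definition row_address :: "nat \<Rightarrow> nat" where
  "row_address i = 8 * (n + length codes + 1) + sum_list (map length (take i rows))"

definition vertex_record :: "nat \<Rightarrow> nat list" where
  "vertex_record x = [column x, label0 x, label1 x, 0, 0, 0, 0, 0]"

definition cut_record :: "nat \<Rightarrow> nat list" where
  "cut_record i = [length (fst (codes ! i)), row_address i] @ snd (codes ! i) @ [0]"

definition records :: "nat list list" where
  "records =
     [n, 0, 0, 0, 0, 0, 0, 0] # map vertex_record [0..<n] @ map cut_record [0..<length codes]"

definition image :: "nat list" where
  "image = concat records @ concat rows"

definition cut_address :: "nat \<Rightarrow> nat" where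
  "cut_address i = 8 * (n + i + 1)"

definition member :: "nat \<Rightarrow> nat \<Rightarrow> bool" where
  "member i x = code_member (codes ! i) (column x)"

lemma length_record: "\<forall>xs\<in>set records. length xs = 8"
  using valid_codes[OF nth_mem]
  by (auto simp: records_def vertex_record_def cut_record_def valid_code_def)

lemma length_records: "length records = n + length codes + 1"
  by (simp add: records_def)

lemma length_concat_records: "length (concat records) = 8 * (n + length codes + 1)"
  by (simp only: length_concat sum_list_length_uniform[OF length_record] length_records)

lemma length_image:
  "length image = 8 * (n + length codes + 1) + (\<Sum>code\<leftarrow>codes. length (fst code))"
  by (simp only: image_def length_append length_concat_records)
    (simp add: length_concat rows_def comp_def)

lemma image_record:
  assumes "q < n + length codes + 1" "j < 8"
  shows "8 * q + j < length image" "image ! (8 * q + j) = records ! q ! j"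
  using nth_concat_uniform[OF length_record, of q j] assms
  by (simp_all add: image_def length_records nth_append)

lemma image_row:
  assumes "i < length codes" "j < length (fst (codes ! i))"
  shows "row_address i + j < length image"
    "image ! (row_address i + j) = of_bool (fst (codes ! i) ! j)"
proof -
  have "row_address i = length (concat records) + sum_list (map length (take i rows))"
    by (simp only: row_address_def length_concat_records)
  moreover have "i < length rows" "j < length (rows ! i)"
      "rows ! i ! j = of_bool (fst (codes ! i) ! j)"
    using assms by (simp_all add: rows_def)
  ultimately show "row_address i + j < length image"
    "image ! (row_address i + j) = of_bool (fst (codes ! i) ! j)"
    using nth_concat_offset[of i rows j] by (simp_all add: image_def nth_append add.assoc)
qed

lemma row_address_le: "row_address i \<le> length image"
proof -
  have "sum_list (map length rows) =
      sum_list (map length (take i rows)) + sum_list (map length (drop i rows))"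
    by (metis append_take_drop_id map_append sum_list_append)
  then show ?thesis
    by (simp add: row_address_def length_image rows_def comp_def take_map drop_map)
qed

lemma image_le_length:
  assumes "\<And>x. x < n \<Longrightarrow> column x \<le> n \<and> label0 x \<le> n \<and> label1 x \<le> n"
    and "x \<in> set image"
  shows "x \<le> length image"
proof -
  have n: "n < length image" by (simp add: length_image)
  have "\<forall>y\<in>set (vertex_record a). y \<le> length image" if "a < n" for a
    using assms(1)[OF that] n by (auto simp: vertex_record_def)
  moreover have "\<forall>y\<in>set (cut_record i). y \<le> length image" if "i < length codes" for i
  proof -
    have "length (fst (codes ! i)) \<le> length image"
      using member_le_sum_list[of "length (fst (codes ! i))" "map (length \<circ> fst) codes"] that
      by (simp add: length_image comp_def)
    moreover have "\<forall>t\<in>set (snd (codes ! i)). t \<le> n"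
      using valid_codes[OF nth_mem[OF that]] by (simp add: valid_code_def)
    ultimately show ?thesis
      using n row_address_le[of i] by (auto simp: cut_record_def)
  qed
  moreover have "\<forall>y\<in>set row. y \<le> length image" if "row \<in> set rows" for row
    using that n by (auto simp: rows_def of_bool_def)
  ultimately show ?thesis
    using assms(2) n by (auto simp: image_def records_def)
qed

end

locale loaded_cut_table = cut_table +
  fixes w :: nat
  assumes image_fits: "length image < 2 ^ w"
begin

definition loaded :: "ram \<Rightarrow> bool" where
  "loaded s \<longleftrightarrow> (\<forall>a<length image. mem s a = image ! a)"

lemma addresses_fit: "i \<le> length codes \<Longrightarrow> x < n \<Longrightarrow> 8 * x + 15 < 2 ^ w \<and> cut_address i < 2 ^ w"
  using image_fits by (simp add: length_image cut_address_def)

lemma loaded_keeps: "loaded s \<Longrightarrow> keeps k s s' \<Longrightarrow> loaded s'"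
  by (simp add: loaded_def keeps_def)

lemma loaded_header: "loaded s \<Longrightarrow> mem s 0 = n"
  using image_record[of 0 0] by (simp add: loaded_def records_def)

lemma loaded_vertex:
  assumes "loaded s" "x < n"
  shows "mem s (8 * x + 8) = column x" "mem s (8 * x + 9) = label0 x"
    "mem s (8 * x + 10) = label1 x"
proof -
  have "mem s (8 * (x + 1) + j) = vertex_record x ! j" if "j < 8" for j
    using image_record[of "x + 1" j] assms that by (simp add: loaded_def records_def nth_append)
  from this[of 0] this[of 1] this[of 2] show "mem s (8 * x + 8) = column x"
    "mem s (8 * x + 9) = label0 x" "mem s (8 * x + 10) = label1 x"
    by (simp_all add: vertex_record_def algebra_simps)
qed

lemma loaded_cut:
  assumes "loaded s" "i < length codes"
  shows "mem s (cut_address i) = length (fst (codes ! i))"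
    "mem s (cut_address i + 1) = row_address i"
    "map (mem s) [cut_address i + 2..<cut_address i + 7] = snd (codes ! i)"
proof -
  have cell: "mem s (cut_address i + j) = cut_record i ! j" if "j < 8" for j
    using image_record[of "n + i + 1" j] assms that
    by (simp add: loaded_def records_def nth_append cut_address_def)
  from cell[of 0] cell[of 1]
  show "mem s (cut_address i) = length (fst (codes ! i))"
    "mem s (cut_address i + 1) = row_address i"
    by (simp_all add: cut_record_def)
  have length_thresholds: "length (snd (codes ! i)) = 5"
    using valid_codes[OF nth_mem[OF assms(2)]] by (simp add: valid_code_def)
  then have "mem s (cut_address i + 2 + j) = snd (codes ! i) ! j" if "j < 5" for j
    using cell[of "Suc (Suc j)"] that by (simp add: cut_record_def nth_append)
  then show "map (mem s) [cut_address i + 2..<cut_address i + 7] = snd (codes ! i)"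
    using length_thresholds by (intro nth_equalityI) simp_all
qed

lemma stored_flag_eq_member:
  assumes "loaded s" "x < n" "i < length codes"
  shows "stored_flag (mem s) x (cut_address i) = of_bool (member i x)"
  using image_row(1,2)[OF assms(3), of "column x"] assms(1)
  unfolding stored_flag_def loaded_vertex[OF assms(1,2)] loaded_cut[OF assms(1,3)]
  by (simp add: member_def code_member_def loaded_def)

lemma run_flag_prog_member:
  assumes s: "loaded s" "regs s 2 = 8" "regs s 3 = 1" "regs s 5 = cut_address i" "i < length codes"
    and x: "regs s 6 = x" "x < n"
  shows "regs (run w flag_prog s) 8 = of_bool (member i x)"
    "keeps 8 s (run w flag_prog s)" "emitted (run w flag_prog s) = emitted s"
proof -
  have "row_address i + column x < 2 ^ w" if "column x < length (fst (codes ! i))"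
    using image_row(1)[OF s(5) that] image_fits by linarith
  moreover have "8 * x + 8 < 2 ^ w" "cut_address i + 6 < 2 ^ w"
    using addresses_fit[of "i + 1" x] s(5) x(2) by (simp_all add: cut_address_def)
  ultimately show "regs (run w flag_prog s) 8 = of_bool (member i x)"
    "keeps 8 s (run w flag_prog s)" "emitted (run w flag_prog s) = emitted s"
    using run_flag_prog[OF s(2,3), of w] stored_flag_eq_member[OF s(1) x(2) s(5)]
    unfolding s(4) x(1) loaded_vertex[OF s(1) x(2)] loaded_cut[OF s(1,5)] by simp_all
qed

lemma run_scan_body:
  assumes s: "loaded s" "regs s 2 = 8" "regs s 3 = 1" "regs s 5 = 8 * (n + i)" "i < length codes"
    and uv: "regs s 0 = u" "u < n" "regs s 1 = v" "v < n"
  shows "regs (run w scan_body s) 15 = of_bool (member i u \<longleftrightarrow> member i v)"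
    "regs (run w scan_body s) 5 = cut_address i"
    "keeps 5 s (run w scan_body s)" "emitted (run w scan_body s) = emitted s"
proof -
  define s1 where "s1 = run w (block [Bin Add 5 5 2, Bin Or 6 0 0]) s"
  have s1: "regs s1 5 = cut_address i" "regs s1 6 = u" "keeps 5 s s1" "emitted s1 = emitted s"
    using s uv addresses_fit[of i u] by (simp_all add: s1_def keeps_def cut_address_def)
  have flag_u: "regs (run w flag_prog s1) 8 = of_bool (member i u)"
      "keeps 8 s1 (run w flag_prog s1)"
      "emitted (run w flag_prog s1) = emitted s1"
    using run_flag_prog_member[OF loaded_keeps[OF s(1) s1(3)] _ _ s1(1) s(5) s1(2) uv(2)]
      s(2,3) s1(3)
    by (simp_all add: keeps_def)
  define s2 where "s2 = run w (block [Bin Or 7 8 8, Bin Or 6 1 1]) (run w flag_prog s1)"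
  have s2: "regs s2 5 = cut_address i" "regs s2 6 = v" "regs s2 7 = of_bool (member i u)"
      "keeps 5 s s2" "emitted s2 = emitted s"
    using flag_u s1 uv(3) by (simp_all add: s2_def keeps_def)
  have flag_v: "regs (run w flag_prog s2) 8 = of_bool (member i v)"
      "keeps 8 s2 (run w flag_prog s2)"
      "emitted (run w flag_prog s2) = emitted s2"
    using run_flag_prog_member[OF loaded_keeps[OF s(1) s2(4)] _ _ s2(1) s(5) s2(2) uv(4)]
      s(2,3) s2(4)
    by (simp_all add: keeps_def)
  have "run w scan_body s = run w (Bin Equal 15 7 8) (run w flag_prog s2)"
    by (simp add: scan_body_def s1_def s2_def)
  then show "regs (run w scan_body s) 15 = of_bool (member i u \<longleftrightarrow> member i v)"
    "regs (run w scan_body s) 5 = cut_address i"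
    "keeps 5 s (run w scan_body s)" "emitted (run w scan_body s) = emitted s"
    using flag_v s2 by (simp_all add: keeps_def)
qed

lemma run_emit_body:
  assumes s: "loaded s" "regs s 2 = 8" "regs s 3 = 1" "regs s 4 = n" "regs s 5 = cut_address i"
      "i < length codes"
    and x: "regs s 6 = x" "x < n"
  shows "regs (run w emit_body s) 15 = of_bool (x + 1 < n)" "regs (run w emit_body s) 6 = x + 1"
    "keeps 6 s (run w emit_body s)"
    "emitted (run w emit_body s) = emitted s @ filter (member i) [x]"
proof -
  have "(x + 1) mod 2 ^ w = x + 1" using addresses_fit[OF _ x(2), of 0] by simp
  then show "regs (run w emit_body s) 15 = of_bool (x + 1 < n)" "regs (run w emit_body s) 6 = x + 1"
    "keeps 6 s (run w emit_body s)"
    "emitted (run w emit_body s) = emitted s @ filter (member i) [x]"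
    using run_flag_prog_member[OF s(1,2,3,5,6) x] s x
    by (simp_all add: emit_body_def keeps_def)
qed

lemma exec_scan_loop:
  assumes s: "loaded s" "regs s 2 = 8" "regs s 3 = 1" "regs s 5 = 8 * n" "regs s 15 = 1"
    and uv: "regs s 0 = u" "u < n" "regs s 1 = v" "v < n"
    and separated: "\<exists>i<length codes. member i u \<noteq> member i v"
  shows "\<exists>t s' i. exec w (While 15 scan_body) s t s' \<and> t \<le> length codes * 101 + 1 \<and>
    i < length codes \<and> member i u \<noteq> member i v \<and>
    regs s' 5 = cut_address i \<and> keeps 5 s s' \<and> emitted s' = emitted s"
proof -
  obtain k where k: "member k u \<noteq> member k v" and before: "\<And>j. j < k \<Longrightarrow> member j u \<longleftrightarrow> member j v"
    using separated exists_least_iff[of "\<lambda>i. member i u \<noteq> member i v"] by blast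
  then have k_less: "k < length codes"
    using separated by (meson le_less_trans not_le_imp_less)
  let ?I = "\<lambda>j s'. keeps 5 s s' \<and> emitted s' = emitted s \<and> regs s' 5 = 8 * (n + j) \<and>
    regs s' 15 = of_bool (j \<le> k)"
  have "\<exists>t s'. exec w (While 15 scan_body) s t s' \<and>
      t \<le> (k + 1) * (cost scan_body + 1) + 1 \<and> ?I (k + 1) s'"
  proof (rule exec_While_invariant[where I = ?I])
    show "loop_free scan_body" by (simp add: scan_body_def loop_free_flag_prog)
  next
    show "?I 0 s" using s by (simp add: keeps_def)
  next
    fix j s' assume j: "j < k + 1" and inv: "?I j s'"
    then have regs: "regs s' 2 = 8" "regs s' 3 = 1" "regs s' 5 = 8 * (n + j)"
        "regs s' 0 = u" "regs s' 1 = v"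
      and "loaded s'" "j < length codes"
      using s uv k_less loaded_keeps by (auto simp: keeps_def)
    note body =
      run_scan_body[OF \<open>loaded s'\<close> regs(1-3) \<open>j < length codes\<close> regs(4) uv(2) regs(5) uv(4)]
    have "(member j u \<longleftrightarrow> member j v) \<longleftrightarrow> Suc j \<le> k"
      using before[of j] k j by (cases "j = k") auto
    then show "regs s' 15 \<noteq> 0 \<and> ?I (Suc j) (run w scan_body s')"
      using body inv j by (simp add: keeps_def cut_address_def)
  qed simp
  then obtain t s' where t: "exec w (While 15 scan_body) s t s'"
      "t \<le> (k + 1) * (cost scan_body + 1) + 1"
    and s': "?I (k + 1) s'"
    by blast
  have "(k + 1) * (cost scan_body + 1) \<le> length codes * 101"
    using k_less cost_scan_body by (intro mult_le_mono) simp_all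
  with t(2) have "t \<le> length codes * 101 + 1" by linarith
  moreover have "regs s' 5 = cut_address k" using s' by (simp add: cut_address_def)
  ultimately show ?thesis using t(1) s' k k_less by blast
qed

lemma exec_emit_loop:
  assumes s: "loaded s" "regs s 2 = 8" "regs s 3 = 1" "regs s 4 = n" "regs s 5 = cut_address i"
      "i < length codes"
    and init: "regs s 6 = 0" "regs s 15 \<noteq> 0" and "0 < n"
  shows "\<exists>t s'. exec w (While 15 emit_body) s t s' \<and> t \<le> n * 51 + 1 \<and> keeps 6 s s' \<and>
    emitted s' = emitted s @ filter (member i) [0..<n]"
proof -
  let ?I = "\<lambda>x s'. keeps 6 s s' \<and> regs s' 6 = x \<and> (regs s' 15 \<noteq> 0 \<longleftrightarrow> x < n) \<and>
    emitted s' = emitted s @ filter (member i) [0..<x]"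
  have "\<exists>t s'. exec w (While 15 emit_body) s t s' \<and> t \<le> n * (cost emit_body + 1) + 1 \<and> ?I n s'"
  proof (rule exec_While_invariant[where I = ?I])
    show "loop_free emit_body" by (simp add: emit_body_def loop_free_flag_prog)
  next
    show "?I 0 s" using init \<open>0 < n\<close> by (simp add: keeps_def)
  next
    fix x s' assume x: "x < n" and inv: "?I x s'"
    then have regs: "regs s' 2 = 8" "regs s' 3 = 1" "regs s' 4 = n" "regs s' 5 = cut_address i"
        "regs s' 6 = x"
      and "loaded s'"
      using s loaded_keeps by (auto simp: keeps_def)
    note body = run_emit_body[OF \<open>loaded s'\<close> regs(1-4) s(6) regs(5) x]
    then show "regs s' 15 \<noteq> 0 \<and> ?I (Suc x) (run w emit_body s')"
      using inv x by (simp add: keeps_def)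
  qed simp
  then obtain t s' where t: "exec w (While 15 emit_body) s t s'"
      "t \<le> n * (cost emit_body + 1) + 1"
    and s': "?I n s'"
    by blast
  have "n * (cost emit_body + 1) \<le> n * 51"
    using cost_emit_body by (intro mult_le_mono) simp_all
  with t(2) have "t \<le> n * 51 + 1" by linarith
  with t(1) s' show ?thesis by blast
qed

lemma exec_report_prog:
  assumes s: "loaded s" "emitted s = []" and uv: "regs s 0 = u" "u < n" "regs s 1 = v" "v < n"
    and codes: "length codes \<le> n" "\<exists>i<length codes. member i u \<noteq> member i v"
  shows "\<exists>t s' i. exec w report_prog s t s' \<and> t \<le> 200 * n \<and> mem s' = mem s \<and>
    i < length codes \<and> member i u \<noteq> member i v \<and> emitted s' = filter (member i) [0..<n]"
proof -
  define s1 where "s1 = run w init_prog s"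
  have "8 * n < 2 ^ w" using addresses_fit[of 0 u] uv(2) by (simp add: cut_address_def)
  moreover have "8 < (2::nat) ^ w" using addresses_fit[of 0 u] uv(2) by simp
  moreover from this have "0 < w" by (cases w) simp_all
  ultimately have s1: "regs s1 2 = 8" "regs s1 3 = 1" "regs s1 4 = n" "regs s1 5 = 8 * n"
      "regs s1 15 = 1" "keeps 2 s s1" "emitted s1 = []"
    using loaded_header[OF s(1)] s(2) by (simp_all add: s1_def init_prog_def keeps_def)
  have "loop_free init_prog" "cost init_prog \<le> 7" by (simp_all add: init_prog_def)
  then obtain t1 where t1: "exec w init_prog s t1 s1" "t1 \<le> 7"
    unfolding s1_def using exec_run le_trans by blast
  have "loaded s1" "regs s1 0 = u" "regs s1 1 = v"
    using loaded_keeps[OF s(1) s1(6)] s1(6) uv by (simp_all add: keeps_def)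
  then obtain t2 s2 i where t2: "exec w (While 15 scan_body) s1 t2 s2" "t2 \<le> length codes * 101 + 1"
    and i: "i < length codes" "member i u \<noteq> member i v"
    and s2: "regs s2 5 = cut_address i" "keeps 5 s1 s2" "emitted s2 = []"
    using exec_scan_loop[of s1 u v] s1 uv codes(2) by metis
  define s3 where "s3 = run w (Const 15 1) (run w (Const 6 0) s2)"
  have s3: "loaded s3" "regs s3 2 = 8" "regs s3 3 = 1" "regs s3 4 = n" "regs s3 5 = cut_address i"
      "regs s3 6 = 0" "regs s3 15 \<noteq> 0" "emitted s3 = []" "mem s3 = mem s"
    using s s1 s2 \<open>0 < w\<close> by (simp_all add: s3_def keeps_def loaded_def)
  obtain t3 s4 where t3: "exec w (While 15 emit_body) s3 t3 s4" "t3 \<le> n * 51 + 1"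
    and s4: "mem s4 = mem s" "emitted s4 = filter (member i) [0..<n]"
    using exec_emit_loop[OF s3(1-5) i(1) s3(6,7)] uv(2) s3(8,9) by (auto simp: keeps_def)
  have "exec w report_prog s (t1 + (t2 + (1 + (1 + (t3 + 1))))) s4"
    unfolding report_prog_def block.simps
    by (intro exec.Seq[OF t1(1)] exec.Seq[OF t2(1)] exec.Seq[OF exec.Const]
        exec.Seq[OF t3(1)[unfolded s3_def run.simps]] exec.Skip)
  moreover have "t1 + (t2 + (1 + (1 + (t3 + 1)))) \<le> 200 * n"
    using t1(2) t2(2) t3(2) codes(1) uv(2) by linarith
  ultimately show ?thesis using s4 i by blast
qed

lemma answers_report:
  assumes "u < n" "v < n" "length codes \<le> n" "\<exists>i<length codes. member i u \<noteq> member i v"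
  shows "answers_query w report_prog image u v (200 * n)
    (\<lambda>out. \<exists>i<length codes. member i u \<noteq> member i v \<and> out = filter (member i) [0..<n])"
  unfolding answers_query_def
proof (intro allI impI)
  fix s assume "query_state w image u v s"
  then have "loaded s" "emitted s = []" "regs s 0 = u" "regs s 1 = v"
    by (auto simp: query_state_def loaded_def)
  then show "\<exists>t s'. exec w report_prog s t s' \<and> t \<le> 200 * n \<and>
      (\<exists>i<length codes. member i u \<noteq> member i v \<and> emitted s' = filter (member i) [0..<n]) \<and>
      (\<forall>a<length image. mem s' a = image ! a)"
    using exec_report_prog[of s u v] assms by (metis loaded_def)
qed

lemma answers_decide:
  assumes "u < n" "v < n"
  shows "answers_query w decide_prog image u v 30
    (\<lambda>out. out = [of_bool (label0 u = label0 v \<and> label1 u \<noteq> label1 v)])"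
  unfolding answers_query_def
proof (intro allI impI)
  fix s assume "query_state w image u v s"
  then have s: "loaded s" "emitted s = []" "regs s 0 = u" "regs s 1 = v"
    by (auto simp: query_state_def loaded_def)
  have "8 * u + 10 < 2 ^ w" "8 * v + 10 < 2 ^ w" "8 < (2::nat) ^ w"
    using addresses_fit[of 0] assms by fastforce+
  moreover from this(3) have "0 < w" by (cases w) simp_all
  ultimately have "emitted (run w decide_prog s) =
        [of_bool (label0 u = label0 v \<and> label1 u \<noteq> label1 v)]"
      "mem (run w decide_prog s) = mem s"
    using s loaded_vertex[OF s(1) assms(1)] loaded_vertex[OF s(1) assms(2)]
    by (auto simp: decide_prog_def add.commute)
  moreover have "loop_free decide_prog" "cost decide_prog \<le> 30"
    by (simp_all add: decide_prog_def)
  ultimately show "\<exists>t s'. exec w decide_prog s t s' \<and> t \<le> 30 \<and>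
      emitted s' = [of_bool (label0 u = label0 v \<and> label1 u \<noteq> label1 v)] \<and>
      (\<forall>a<length image. mem s' a = image ! a)"
    using s(1) exec_run[of decide_prog w s] le_trans unfolding loaded_def by metis
qed

end

section \<open>The data structure\<close>

lemma inseparability_labels:
  obtains label :: "nat \<Rightarrow> nat" where "\<And>a. label a \<le> a"
    "\<And>a b. label a = label b \<longleftrightarrow> inseparable F (f a) (f b)"
proof -
  define label where "label a = (LEAST c. inseparable F (f a) (f c))" for a
  have label: "inseparable F (f a) (f (label a))" for a
    unfolding label_def by (rule LeastI[of _ a]) (rule inseparable_refl)
  show ?thesis
  proof (rule that[of label])
    show "label a \<le> a" for a
      unfolding label_def by (rule Least_le) (rule inseparable_refl)
    show "label a = label b \<longleftrightarrow> inseparable F (f a) (f b)" for a b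
    proof
      assume "label a = label b"
      then show "inseparable F (f a) (f b)"
        using label[of a] label[of b] inseparable_sym inseparable_trans by metis
    next
      assume "inseparable F (f a) (f b)"
      then have "inseparable F (f a) (f c) \<longleftrightarrow> inseparable F (f b) (f c)" for c
        using inseparable_sym inseparable_trans by metis
      then show "label a = label b" by (simp add: label_def)
    qed
  qed
qed

locale steiner_cut_table =
  steiner_multigraph V E S + loaded_cut_table n column label0 label1 codes w
  for V :: "'a set" and E S n column label0 label1 codes w +
  fixes idx :: "'a \<Rightarrow> nat" and xs :: "'a list"
  assumes idx: "bij_betw idx V {..<n}" and set_xs: "set xs = V" and distinct_xs: "distinct xs"
    and column: "x \<in> V \<Longrightarrow> column (idx x) = index_of xs x"
    and label0: "u \<in> V \<Longrightarrow> v \<in> V \<Longrightarrow> label0 (idx u) = label0 (idx v) \<longleftrightarrow> inseparable (cuts mincap) u v"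
    and label1: "u \<in> V \<Longrightarrow> v \<in> V \<Longrightarrow>
      label1 (idx u) = label1 (idx v) \<longleftrightarrow> inseparable (cuts (mincap + 1)) u v"
    and label_le: "label0 a \<le> a" "label1 a \<le> a"
    and length_codes: "length codes \<le> n"
    and decode_cuts: "decode xs ` set codes \<subseteq> cuts (mincap + 1)"
    and resolves_codes: "resolves (decode xs ` set codes) (cuts (mincap + 1)) V"
begin

lemma idx_less: "x \<in> V \<Longrightarrow> idx x < n"
  using idx by (auto simp: bij_betw_def)

lemma column_less:
  assumes "a < n"
  shows "column a < n"
proof -
  obtain x where "x \<in> V" "a = idx x"
    using assms idx by (auto simp: bij_betw_def)
  moreover have "length xs = n"
    using distinct_card[OF distinct_xs] set_xs bij_betw_same_card[OF idx] by simp
  ultimately show ?thesis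
    using index_of_less_length[of x xs] set_xs by (simp add: column)
qed

lemma image_less: "\<forall>a\<in>set image. a < 2 ^ w"
proof
  fix a assume "a \<in> set image"
  moreover have "column b \<le> n \<and> label0 b \<le> n \<and> label1 b \<le> n" if "b < n" for b
    using column_less[OF that] label_le[of b] that by simp
  ultimately have "a \<le> length image"
    by (intro image_le_length)
  with image_fits show "a < 2 ^ w" by simp
qed

lemma member_idx_iff: "x \<in> V \<Longrightarrow> member i (idx x) \<longleftrightarrow> x \<in> decode xs (codes ! i)"
  by (simp add: member_def column decode_def set_xs)

lemma image_idx_decode: "idx ` decode xs (codes ! i) = {a. a < n \<and> member i a}"
proof -
  have "{a. a < n \<and> member i a} = {a \<in> idx ` V. member i a}"
    using idx by (auto simp: bij_betw_def)
  also have "\<dots> = idx ` decode xs (codes ! i)"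
    using member_idx_iff by (auto simp: decode_def set_xs)
  finally show ?thesis by simp
qed

lemma decide_correct:
  assumes "u \<in> V" "v \<in> V"
  shows "answers_query w decide_prog image (idx u) (idx v) 30
    (\<lambda>out. out = [of_bool (\<exists>C. least_separating_steiner_cut V E S u v C \<and> cap C = mincap + 1)])"
  using answers_decide[OF idx_less[OF assms(1)] idx_less[OF assms(2)]]
  unfolding least_separating_steiner_cut_iff label0[OF assms] label1[OF assms] .

lemma report_correct:
  assumes uv: "u \<in> V" "v \<in> V" and "\<exists>C. steiner_cut V S C \<and> separates C u v \<and> cap C = mincap + 1"
  shows "answers_query w report_prog image (idx u) (idx v) (200 * n)
    (\<lambda>out. \<exists>C. steiner_cut V S C \<and> separates C u v \<and> cap C = mincap + 1 \<and>
       distinct out \<and> set out = idx ` C)"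
proof -
  have separates: "separates (decode xs (codes ! i)) u v \<longleftrightarrow> member i (idx u) \<noteq> member i (idx v)"
    for i
    using uv by (simp add: separates_def member_idx_iff)
  have "\<not> inseparable (cuts (mincap + 1)) u v"
    using assms(3) by (auto simp: inseparable_def cuts_def)
  then have "\<not> inseparable (decode xs ` set codes) u v"
    using resolves_codes uv by (auto simp: resolves_def)
  then have "\<exists>i<length codes. member i (idx u) \<noteq> member i (idx v)"
    unfolding separates[symmetric] inseparable_def by (metis imageE in_set_conv_nth)
  from answers_report[OF idx_less[OF uv(1)] idx_less[OF uv(2)] length_codes this] show ?thesis
  proof (rule answers_query_mono, elim exE conjE)
    fix out i assume i: "i < length codes" "member i (idx u) \<noteq> member i (idx v)"
      and out: "out = filter (member i) [0..<n]"
    have "decode xs (codes ! i) \<in> cuts (mincap + 1)"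
      using decode_cuts i(1) by auto
    moreover have "distinct out" "set out = idx ` decode xs (codes ! i)"
      unfolding image_idx_decode out by auto
    ultimately show "\<exists>C. steiner_cut V S C \<and> separates C u v \<and> cap C = mincap + 1 \<and>
        distinct out \<and> set out = idx ` C"
      using separates i(2) by (auto simp: cuts_def)
  qed
qed

end

lemma (in cut_table) length_image_le:
  assumes "2 \<le> n" "length codes \<le> n" "(\<Sum>code\<leftarrow>codes. length (fst code)) \<le> 2 * (n * k)"
  shows "length image \<le> 20 * (n * (k + 1))"
proof -
  have "length image \<le> 20 * n + 20 * (n * k)"
    using assms by (simp add: length_image)
  then show ?thesis by (simp add: algebra_simps)
qed

lemma space_bound_less_power:
  fixes n k w :: nat
  assumes "2 \<le> n" "k + 1 \<le> n" "n ^ 8 \<le> 2 ^ w"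
  shows "20 * (n * (k + 1)) < 2 ^ w"
proof -
  have "20 * (n * (k + 1)) \<le> 20 * (n * n)"
    using assms(2) by (intro mult_le_mono) simp_all
  also have "\<dots> < 2 ^ 6 * n ^ 2"
    using assms(1) by (simp add: power2_eq_square)
  also have "\<dots> \<le> n ^ 6 * n ^ 2"
    using assms(1) by (intro mult_le_mono1 power_mono) simp_all
  also have "\<dots> = n ^ 8" by (simp flip: power_add)
  finally show ?thesis using assms(3) by simp
qed

lemma (in steiner_multigraph) steiner_cut_table_exists:
  assumes idx: "bij_betw idx V {..<n}" and w: "n ^ 8 \<le> 2 ^ w"
  obtains column label0 label1 codes xs where
    "steiner_cut_table V E S n column label0 label1 codes w idx xs"
    "length (cut_table.image n column label0 label1 codes) \<le> 20 * (n * (n - card S + 1))"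
proof -
  have card_V: "card V = n" using bij_betw_same_card[OF idx] by simp
  have n: "2 \<le> n" "n - card S + 1 \<le> n" using card_S card_S_le card_V by linarith+
  obtain xs codes where xs: "distinct xs" "set xs = V" and codes: "length codes \<le> n"
      "(\<Sum>code\<leftarrow>codes. length (fst code)) \<le> 2 * (n * (n - card S))"
      "\<forall>code\<in>set codes. valid_code n code" "decode xs ` set codes \<subseteq> cuts (mincap + 1)"
      "resolves (decode xs ` set codes) (cuts (mincap + 1)) V"
    by (rule resolving_codes) (simp add: card_V card_nonterminals)
  define vertex where "vertex = inv_into V idx"
  have vertex: "vertex (idx x) = x" if "x \<in> V" for x
    using idx that by (simp add: vertex_def bij_betw_def)
  define column where "column a = index_of xs (vertex a)" for a
  obtain label0 where label0: "\<And>a. label0 a \<le> a"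
      "\<And>a b. label0 a = label0 b \<longleftrightarrow> inseparable (cuts mincap) (vertex a) (vertex b)"
    using inseparability_labels[of "cuts mincap" vertex] by blast
  obtain label1 where label1: "\<And>a. label1 a \<le> a"
      "\<And>a b. label1 a = label1 b \<longleftrightarrow> inseparable (cuts (mincap + 1)) (vertex a) (vertex b)"
    using inseparability_labels[of "cuts (mincap + 1)" vertex] by blast
  interpret cut_table n column label0 label1 codes
    using codes(3) by unfold_locales blast
  have space: "length image \<le> 20 * (n * (n - card S + 1))"
    by (rule length_image_le[OF n(1) codes(1,2)])
  also have "\<dots> < 2 ^ w"
    by (rule space_bound_less_power[OF n w])
  finally have "length image < 2 ^ w" .
  then have "steiner_cut_table V E S n column label0 label1 codes w idx xs"
    using idx xs codes label0 label1 by unfold_locales (simp_all add: vertex column_def)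
  then show ?thesis using that space by blast
qed

theorem theorem3:
  "\<exists>(decide :: prog) (report :: prog) (c_word :: nat) (c_space :: nat) (c_decide :: nat) (c_report :: nat).
     \<forall>(V :: 'a set) (E :: 'a set multiset) (S :: 'a set) (idx :: 'a \<Rightarrow> nat) (n :: nat) (w :: nat).
       connected_multigraph V E \<and> card V = n \<and> S \<subseteq> V \<and> card S \<ge> 2 \<and>
       bij_betw idx V {..<n} \<and> n ^ c_word \<le> 2 ^ w \<longrightarrow>
       (\<exists>D :: nat list.
          (\<forall>x\<in>set D. x < 2 ^ w) \<and>
          length D \<le> c_space * (n * (n - card S + 1)) \<and>
          (\<forall>u\<in>V. \<forall>v\<in>V.
             answers_query w decide D (idx u) (idx v) c_decide
               (\<lambda>out. out = [of_bool (\<exists>C. least_separating_steiner_cut V E S u v C \<and>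
                                          capacity V E C = mincut_capacity V E S + 1)]) \<and>
             ((\<exists>C. steiner_cut V S C \<and> separates C u v \<and>
                   capacity V E C = mincut_capacity V E S + 1) \<longrightarrow>
              answers_query w report D (idx u) (idx v) (c_report * n)
                (\<lambda>out. \<exists>C. steiner_cut V S C \<and> separates C u v \<and>
                           capacity V E C = mincut_capacity V E S + 1 \<and>
                           distinct out \<and> set out = idx ` C))))"
proof (rule exI[of _ decide_prog], rule exI[of _ report_prog], rule exI[of _ 8], rule exI[of _ 20],
    rule exI[of _ 30], rule exI[of _ 200], intro allI impI, elim conjE, goal_cases steiner)
  case (steiner V E S idx n w)
  then interpret steiner_multigraph V E S
    by unfold_locales (simp_all add: connected_multigraph_def)
  obtain column label0 label1 codes xs where
      table: "steiner_cut_table V E S n column label0 label1 codes w idx xs"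
    and space: "length (cut_table.image n column label0 label1 codes) \<le> 20 * (n * (n - card S + 1))"
    using steiner_cut_table_exists steiner by blast
  interpret steiner_cut_table V E S n column label0 label1 codes w idx xs
    by (rule table)
  show ?case
    using image_less space decide_correct report_correct by blast
qed

end
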